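(* Let $d\ge2$ and fix positive constants $\theta_0,\dots,\theta_d>0$ with $|\boldsymbol{\theta}|:=\theta_0+\dots+\theta_d\le1$. Consider the Diaconis and Freedman's chain $(Z_n)_{n\ge0}$ on $\Delta_d$ with weight functions, for $\mathbf{y}=(y_1,\dots,y_d)\in\Delta_d$, $$p_i(\mathbf{y})=\theta_i+(1-|\boldsymbol{\theta}|)\,y_i,\qquad i=1,\dots,d$$ (which implies $p_0(\mathbf{y})=\theta_0+(1-|\boldsymbol{\theta}|)\,y_0$ with $y_0:=1-y_1-\dots-y_d$). Then the unique invariant probability density $g_\infty$ of $(Z_n)_{n\ge0}$ is the density of the Dirichlet distribution $Dir[\theta_0,\dots,\theta_d]$: $$g_\infty(\mathbf{y})=\frac{\Gamma(|\boldsymbol{\theta}|)}{\prod_{i=0}^d\Gamma(\theta_i)}\prod_{i=0}^d y_i^{\theta_i-1}\ \mathbf{1}_{\mathring{\Delta}_d}(\mathbf{y}).$$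
   Context: $\Delta_d=\{\mathbf{x}\in\mathbb{R}^d: x_i\ge0,\ x_1+\dots+x_d\le 1\}$ is the closed simplex with interior $\mathring{\Delta}_d$ and vertices $\mathbf{e}_0=(0,\dots,0)$ and $\mathbf{e}_i$ the $i$-th standard basis vector, $1\le i\le d$. Given nonnegative continuous weight functions $p_0,\dots,p_d$ on $\Delta_d$ with $\sum_{i=0}^d p_i(\mathbf{x})=1$, the Diaconis and Freedman's chain $(Z_n)_{n\ge0}$ is the Markov chain on $\Delta_d$ which, when at $\mathbf{x}$, chooses the vertex $\mathbf{e}_i$ with probability $p_i(\mathbf{x})$ and then moves to $t\mathbf{x}+(1-t)\mathbf{e}_i$ with $t$ uniform on $(0,1)$. Its transition operator is $Pf(\mathbf{x})=\sum_{i=0}^d p_i(\mathbf{x})\int_0^1 f(t\mathbf{x}+(1-t)\mathbf{e}_i)\,dt$ for bounded measurable $f$. The dual operator $P^*$ on $L^1(\Delta_d)$ (Lebesgue measure) is defined by $\int_{\Delta_d} Pf\cdot g\,d\mathbf{x}=\int_{\Delta_d} f\cdot P^*g\,d\mathbf{x}$ for all bounded measurable $f$. An invariant probability density is a function $g\in L^1(\Delta_d)$ with $g\ge0$, $\int_{\Delta_d} g=1$ and $P^*g=g$ (uniqueness is as an element of $L^1$). *)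

theory Defs
  imports "HOL-Analysis.Analysis"
begin

text \<open>The index set {0,...,d} is rendered as the type \<open>'n option\<close> with d = CARD('n):
  \<open>None\<close> plays the role of 0 and \<open>Some i\<close> that of the coordinates 1,...,d.\<close>

definition unit_simplex :: "(real ^ 'n) set" where
  "unit_simplex = {x. (\<forall>i. 0 \<le> x $ i) \<and> (\<Sum>i\<in>UNIV. x $ i) \<le> 1}"

definition simplex_vertex :: "'n option \<Rightarrow> real ^ 'n" where
  "simplex_vertex i = (case i of None \<Rightarrow> 0 | Some j \<Rightarrow> axis j 1)"

definition bary_coord :: "real ^ 'n \<Rightarrow> 'n option \<Rightarrow> real" where
  "bary_coord y i = (case i of None \<Rightarrow> 1 - (\<Sum>j\<in>UNIV. y $ j) | Some j \<Rightarrow> y $ j)"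

definition df_weights :: "('n::finite option \<Rightarrow> real ^ 'n \<Rightarrow> real) \<Rightarrow> bool" where
  "df_weights p \<longleftrightarrow>
     (\<forall>i. continuous_on unit_simplex (p i)) \<and>
     (\<forall>i. \<forall>x\<in>unit_simplex. 0 \<le> p i x) \<and>
     (\<forall>x\<in>unit_simplex. (\<Sum>i\<in>UNIV. p i x) = 1)"

text \<open>Transition operator of the Diaconis--Freedman chain: from x, the vertex with index i is
  chosen with probability \<open>p i x\<close>, and the chain moves to a uniform point on the segment
  joining x to that vertex.\<close>

definition df_operator ::
  "('n::finite option \<Rightarrow> real ^ 'n \<Rightarrow> real) \<Rightarrow> (real ^ 'n \<Rightarrow> real) \<Rightarrow> real ^ 'n \<Rightarrow> real" where
  "df_operator p f x =
     (\<Sum>i\<in>UNIV. p i x *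
        (LINT t:{0..1}|lborel. f (t *\<^sub>R x + (1 - t) *\<^sub>R simplex_vertex i)))"

text \<open>\<open>df_dual p g h\<close> says that h is (a representative of) the image of g under the dual
  operator on L1 of the simplex.  The test functions are Borel, not merely Lebesgue, measurable:
  a Lebesgue measurable function need not be measurable along a given segment.\<close>

definition df_dual ::
  "('n::finite option \<Rightarrow> real ^ 'n \<Rightarrow> real) \<Rightarrow> (real ^ 'n \<Rightarrow> real) \<Rightarrow> (real ^ 'n \<Rightarrow> real) \<Rightarrow> bool" where
  "df_dual p g h \<longleftrightarrow>
     integrable (lebesgue_on unit_simplex) g \<and>
     integrable (lebesgue_on unit_simplex) h \<and>
     (\<forall>f. f \<in> borel_measurable (restrict_space borel unit_simplex) \<and> bounded (f ` unit_simplex) \<longrightarrow>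
        (LINT x|lebesgue_on unit_simplex. df_operator p f x * g x) =
        (LINT x|lebesgue_on unit_simplex. f x * h x))"

definition df_invariant_density ::
  "('n::finite option \<Rightarrow> real ^ 'n \<Rightarrow> real) \<Rightarrow> (real ^ 'n \<Rightarrow> real) \<Rightarrow> bool" where
  "df_invariant_density p g \<longleftrightarrow>
     integrable (lebesgue_on unit_simplex) g \<and>
     (AE x in lebesgue_on unit_simplex. 0 \<le> g x) \<and>
     (LINT x|lebesgue_on unit_simplex. g x) = 1 \<and>
     df_dual p g g"

definition dirichlet_density :: "('n::finite option \<Rightarrow> real) \<Rightarrow> real ^ 'n \<Rightarrow> real" where
  "dirichlet_density \<theta> y =
     Gamma (\<Sum>i\<in>UNIV. \<theta> i) / (\<Prod>i\<in>UNIV. Gamma (\<theta> i)) *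
     (\<Prod>i\<in>UNIV. bary_coord y i powr (\<theta> i - 1)) *
     indicator (interior unit_simplex) y"

end

theory Submission
  imports Defs
begin

text \<open>The proof tests invariance on the Bernstein polynomials
\<open>B \<alpha> = n! / (\<Prod>i. \<alpha> i!) * (\<Prod>i. x i ^ \<alpha> i)\<close>, where \<open>n\<close> is the sum of the exponents and \<open>x i\<close> are
the \<open>d + 1\<close> barycentric coordinates. The average of \<open>B \<alpha>\<close> over the segment from \<open>x\<close> to the
\<open>i\<close>-th vertex is \<open>(\<Sum>k\<le>\<alpha> i. B (\<alpha>(i := k)) x) / (n + 1)\<close>
(\<open>LINT_bernstein_poly_segment\<close>), and a barycentric coordinate times a Bernstein polynomial is a
multiple of a Bernstein polynomial. Since the weights are affine, the transition operator is
therefore triangular (\<open>df_operator_bernstein_poly\<close>): it maps \<open>B \<alpha>\<close> to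
\<open>(2 - |\<theta>|) / (n + 1) * B \<alpha>\<close> plus explicit multiples of Bernstein polynomials of lower degree.

As \<open>|\<theta>| > 0\<close>, the diagonal entry differs from 1 for every \<open>n > 0\<close>. The moments \<open>\<integral> B \<alpha> * g\<close> of an
invariant density \<open>g\<close> thus satisfy a recurrence that determines them from the total mass. Its
solution is found by a telescoping sum (\<open>sum_moment_coeff_dirichlet_moment\<close>): it is
\<open>n! / (|\<theta>|)\<^sub>n * (\<Prod>i. (\<theta> i)\<^sub>k / k!)\<close> with \<open>k = \<alpha> i\<close> and rising factorials, and these are the moments
of the Dirichlet distribution by the Dirichlet integral (\<open>dirichlet_integral\<close>).

By Stone--Weierstrass, finite Borel measures on the simplex with the same moments are equal
(\<open>measure_on_simplex_eqI\<close>). This gives uniqueness, because any two invariant densities have the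
same moments. It also gives existence: by \<open>df_operator_dual_measure\<close> the integral of \<open>P f\<close> against
the Dirichlet distribution is the integral of \<open>f\<close> against the law of the chain after one step, and
by the recurrence this law has the moments of the Dirichlet distribution.\<close>

section \<open>Finite measures on the simplex are determined by their moments\<close>

text \<open>By Stone--Weierstrass, equality of the integrals passes from polynomials to continuous functions.
The continuous functions \<open>max 0 (1 - k * infdist x C)\<close> decrease to the indicator of a closed
set \<open>C\<close>, so the measures agree on closed sets, an intersection-stable generator of the Borel sets.\<close>

lemma measure_eq_if_polynomial_integrals_eq:
  fixes M N :: "'a::euclidean_space measure"
  assumes "finite_measure M" "finite_measure N"
    and sets: "sets M = sets borel" "sets N = sets borel"
    and S: "compact S" "AE x in M. x \<in> S" "AE x in N. x \<in> S"
    and poly: "\<And>q. real_polynomial_function q \<Longrightarrow> (LINT x|M. q x) = (LINT x|N. q x)"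
  shows "M = N"
proof -
  interpret M: finite_measure M by fact
  interpret N: finite_measure N by fact
  have [measurable_cong]: "sets M = sets borel" "sets N = sets borel" by (fact sets)+
  have int: "integrable M f \<and> integrable N f" if f: "continuous_on UNIV f" for f :: "'a \<Rightarrow> real"
  proof -
    have "compact (f ` S)"
      using S(1) f by (meson compact_continuous_image continuous_on_subset subset_UNIV)
    then obtain B where B: "\<And>x. x \<in> S \<Longrightarrow> norm (f x) \<le> B"
      using compact_imp_bounded bounded_iff by (metis image_eqI)
    have [measurable]: "f \<in> borel_measurable borel"
      using f by (rule borel_measurable_continuous_onI)
    show ?thesis
      using S B by (auto intro!: M.integrable_const_bound[of _ B] N.integrable_const_bound[of _ B])
  qed
  have cont: "(LINT x|M. f x) = (LINT x|N. f x)" if f: "continuous_on UNIV f" for f :: "'a \<Rightarrow> real"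
  proof (rule ccontr)
    assume ne: "(LINT x|M. f x) \<noteq> (LINT x|N. f x)"
    define m where "m = measure M (space M) + measure N (space N)"
    define \<delta> where "\<delta> = \<bar>(LINT x|M. f x) - (LINT x|N. f x)\<bar>"
    (* An error of e in the uniform norm changes the difference of the integrals by at most
       e * m; adding 1 to m makes e well defined and e * m < \<delta> even when m = 0. *)
    define e where "e = \<delta> / (m + 1)"
    have m: "0 \<le> m" by (simp add: m_def)
    have \<delta>: "0 < \<delta>" using ne by (simp add: \<delta>_def)
    have e: "0 < e" using m \<delta> by (simp add: e_def)
    have "continuous_on S f" using f continuous_on_subset by blast
    then obtain q where q: "real_polynomial_function q" "\<And>x. x \<in> S \<Longrightarrow> \<bar>f x - q x\<bar> < e"
      using Stone_Weierstrass_real_polynomial_function[OF S(1) _ e] by metis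
    have qc: "continuous_on UNIV q"
      using q(1) by (simp add: continuous_on_polymonial_function real_polynomial_function_eq)
    have close: "\<bar>(LINT x|K. f x) - (LINT x|K. q x)\<bar> \<le> e * measure K (space K)"
      if K: "finite_measure K" "AE x in K. x \<in> S" "integrable K f" "integrable K q" for K
    proof -
      interpret K: finite_measure K by fact
      have "\<bar>(LINT x|K. f x) - (LINT x|K. q x)\<bar> = \<bar>LINT x|K. f x - q x\<bar>"
        using K by simp
      also have "\<dots> \<le> (LINT x|K. \<bar>f x - q x\<bar>)" by (rule integral_abs_bound)
      also have "\<dots> \<le> (LINT x|K. e)"
        using K q(2) by (intro integral_mono_AE) (auto elim!: eventually_mono intro: less_imp_le)
      finally show ?thesis by (simp add: mult.commute)
    qed
    have "\<delta> \<le> e * measure M (space M) + e * measure N (space N)"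
      using close[of M] close[of N] int[OF f] int[OF qc] S assms(1,2) poly[OF q(1)]
      unfolding \<delta>_def by linarith
    also have "\<dots> = e * m" by (simp add: m_def algebra_simps)
    also have "\<dots> < \<delta>"
      using m \<delta> by (simp add: e_def field_simps)
    finally show False by simp
  qed
  have closed: "measure M C = measure N C" if C: "closed C" for C
  proof (cases "C = {}")
    case False
    define f where "f = (\<lambda>k x. max 0 (1 - real k * infdist x C))"
    have lim: "(\<lambda>k. f k x) \<longlonglongrightarrow> indicator C x" for x
    proof (cases "x \<in> C")
      case True
      then show ?thesis by (simp add: f_def)
    next
      case x: False
      then have pos: "0 < infdist x C" using infdist_pos_not_in_closed[OF C False] by simp
      have "eventually (\<lambda>k. f k x = 0) sequentially"
        using eventually_ge_at_top[of "nat \<lceil>1 / infdist x C\<rceil>"]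
      proof eventually_elim
        case (elim k)
        then have "1 / infdist x C \<le> real k" by linarith
        then show ?case using pos by (simp add: f_def field_simps)
      qed
      then show ?thesis using x by (simp add: tendsto_eventually)
    qed
    have fc: "continuous_on UNIV (f k)" for k
      unfolding f_def by (intro continuous_intros)
    have [measurable]: "f k \<in> borel_measurable borel" for k
      using fc by (rule borel_measurable_continuous_onI)
    have bd: "norm (f k x) \<le> 1" for k x
      by (simp add: f_def infdist_nonneg)
    have *: "(\<lambda>k. LINT x|K. f k x) \<longlonglongrightarrow> measure K C"
      if "finite_measure K" and [measurable_cong]: "sets K = sets borel" for K
    proof -
      interpret K: finite_measure K by fact
      have [measurable]: "C \<in> sets K" using C that by simp
      have "(\<lambda>k. LINT x|K. f k x) \<longlonglongrightarrow> (LINT x|K. indicator C x)"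
        using bd lim by (intro integral_dominated_convergence[where w="\<lambda>_. 1"]) auto
      then show ?thesis using sets_eq_imp_space_eq[OF that(2)] by simp
    qed
    show ?thesis
      using *[OF assms(1) sets(1)] *[OF assms(2) sets(2)] cont[OF fc]
      by (auto intro: LIMSEQ_unique)
  qed auto
  show ?thesis
  proof (rule measure_eqI_generator_eq[where E="Collect closed" and \<Omega>=UNIV and A="\<lambda>_. UNIV"])
    show "Int_stable (Collect closed)" by (auto simp: Int_stable_def)
    show "sets M = sigma_sets UNIV (Collect closed)" "sets N = sigma_sets UNIV (Collect closed)"
      by (simp_all add: sets borel_eq_closed)
  qed (auto simp: M.emeasure_eq_measure N.emeasure_eq_measure closed)
qed

definition bary_monomial :: "('n::finite option \<Rightarrow> nat) \<Rightarrow> real ^ 'n \<Rightarrow> real" where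
  "bary_monomial \<alpha> x = (\<Prod>i\<in>UNIV. bary_coord x i ^ \<alpha> i)"

lemma sum_option_UNIV: "(\<Sum>i\<in>UNIV. f i) = f None + (\<Sum>i\<in>UNIV. f (Some i))"
  for f :: "'n::finite option \<Rightarrow> 'b::comm_monoid_add"
  by (simp add: UNIV_option_conv sum.reindex)

lemma prod_option_UNIV: "(\<Prod>i\<in>UNIV. f i) = f None * (\<Prod>i\<in>UNIV. f (Some i))"
  for f :: "'n::finite option \<Rightarrow> 'b::comm_monoid_mult"
  by (simp add: UNIV_option_conv prod.reindex)

lemma sum_bary_coord: "(\<Sum>i\<in>UNIV. bary_coord x i) = 1"
  by (simp add: sum_option_UNIV bary_coord_def)

lemma bary_coord_nonneg_iff: "x \<in> unit_simplex \<longleftrightarrow> (\<forall>i. 0 \<le> bary_coord x i)"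
  by (auto simp: unit_simplex_def bary_coord_def split: option.splits)

lemma bary_coord_le_1: "x \<in> unit_simplex \<Longrightarrow> bary_coord x i \<le> 1"
  using member_le_sum[of i UNIV "bary_coord x"] by (simp add: sum_bary_coord bary_coord_nonneg_iff)

lemma continuous_on_bary_coord [continuous_intros]:
  "continuous_on A f \<Longrightarrow> continuous_on A (\<lambda>x. bary_coord (f x) i)"
  by (cases i) (auto simp: bary_coord_def intro!: continuous_intros)

lemma borel_measurable_bary_coord [measurable]:
  "(\<lambda>x. bary_coord x i) \<in> borel_measurable borel"
  by (intro borel_measurable_continuous_onI continuous_intros)

lemma borel_measurable_bary_monomial [measurable]: "bary_monomial \<alpha> \<in> borel_measurable borel"
  unfolding bary_monomial_def by measurable

lemma bary_monomial_0 [simp]: "bary_monomial (\<lambda>_. 0) x = 1"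
  by (simp add: bary_monomial_def)

lemma bary_monomial_mult:
  "bary_monomial \<alpha> x * bary_monomial \<beta> x = bary_monomial (\<lambda>i. \<alpha> i + \<beta> i) x"
  by (simp add: bary_monomial_def power_add prod.distrib)

lemma bary_coord_eq_monomial: "bary_coord x i = bary_monomial (\<lambda>j. if j = i then 1 else 0) x"
proof -
  have "(\<lambda>j. bary_coord x j ^ (if j = i then 1 else 0)) = (\<lambda>j. if j = i then bary_coord x j else 1)"
    by auto
  then show ?thesis by (simp only: bary_monomial_def) simp
qed

lemma bary_monomial_bounds:
  assumes "x \<in> unit_simplex" shows "0 \<le> bary_monomial \<alpha> x" "bary_monomial \<alpha> x \<le> 1"
  using assms unfolding bary_monomial_def
  by (auto intro!: prod_nonneg prod_le_1 power_le_one simp: bary_coord_le_1 bary_coord_nonneg_iff)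

lemma compact_unit_simplex: "compact (unit_simplex :: (real^'n) set)"
proof -
  have eq: "unit_simplex = (\<Inter>i. {x::real^'n. 0 \<le> bary_coord x i})"
    by (auto simp: bary_coord_nonneg_iff)
  have "closed (unit_simplex :: (real^'n) set)"
    unfolding eq by (intro closed_INT ballI closed_Collect_le continuous_intros)
  moreover have "bounded (unit_simplex :: (real^'n) set)"
  proof (rule bounded_subset[OF bounded_cbox])
    have "x $ i \<le> 1" if "x \<in> unit_simplex" for x :: "real^'n" and i
      using bary_coord_le_1[OF that, of "Some i"] by (simp add: bary_coord_def)
    then show "unit_simplex \<subseteq> cbox (0::real^'n) (\<chi> i. 1)"
      by (auto simp: mem_box_cart unit_simplex_def)
  qed
  ultimately show ?thesis
    by (simp add: compact_eq_bounded_closed)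
qed

text \<open>The linear span of the monomials in barycentric coordinates. In this inductive form, closure under
products follows by two nested inductions.\<close>

inductive bary_polynomial :: "(real ^ 'n::finite \<Rightarrow> real) \<Rightarrow> bool" where
  monomial: "bary_polynomial (\<lambda>x. c * bary_monomial \<alpha> x)"
| add: "bary_polynomial f \<Longrightarrow> bary_polynomial g \<Longrightarrow> bary_polynomial (\<lambda>x. f x + g x)"

lemma bary_polynomial_const: "bary_polynomial (\<lambda>x. c)"
  using monomial[of c "\<lambda>_. 0"] by simp

lemma bary_polynomial_sum:
  "finite I \<Longrightarrow> (\<And>i. i \<in> I \<Longrightarrow> bary_polynomial (f i)) \<Longrightarrow> bary_polynomial (\<lambda>x. \<Sum>i\<in>I. f i x)"
proof (induction I rule: finite_induct)
  case empty
  then show ?case using bary_polynomial_const[of 0] by simp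
qed (auto intro: add)

lemma bary_polynomial_mult:
  assumes "bary_polynomial f" "bary_polynomial g"
  shows "bary_polynomial (\<lambda>x. f x * g x)"
  using assms(1)
proof induction
  case (monomial c \<alpha>)
  show ?case using assms(2)
  proof induction
    case (monomial d \<beta>)
    then show ?case
      using bary_polynomial.monomial[of "c * d" "\<lambda>i. \<alpha> i + \<beta> i"]
      by (simp add: bary_monomial_mult[symmetric] ac_simps)
  qed (auto simp: distrib_left intro: add)
qed (auto simp: distrib_right intro: add)

text \<open>Both notions of polynomial are closed under sums and products, and the coordinate functions are
themselves barycentric coordinates.\<close>

lemma real_polynomial_function_imp_bary_polynomial:
  fixes q :: "real ^ 'n::finite \<Rightarrow> real"
  assumes "real_polynomial_function q" shows "bary_polynomial q"
  using assms
proof induction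
  case (linear f)
  have "f x = (\<Sum>i\<in>UNIV. f (axis i 1) * bary_monomial (\<lambda>j. if j = Some i then 1 else 0) x)" for x
  proof -
    have "f x = f (\<Sum>i\<in>UNIV. x $ i *\<^sub>R axis i 1)"
      by (simp add: basis_expansion flip: scalar_mult_eq_scaleR)
    also have "\<dots> = (\<Sum>i\<in>UNIV. x $ i * f (axis i 1))"
      using linear by (simp add: linear_sum linear_scale bounded_linear.linear)
    finally show ?thesis
      by (simp add: bary_coord_eq_monomial[symmetric] bary_coord_def mult.commute)
  qed
  then have "f = (\<lambda>x. \<Sum>i\<in>UNIV. f (axis i 1) * bary_monomial (\<lambda>j. if j = Some i then 1 else 0) x)"
    by (rule ext)
  then show ?case
    by (rule ssubst) (auto intro!: bary_polynomial_sum monomial)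
qed (auto intro: bary_polynomial_const bary_polynomial_mult add)

text \<open>Moment determinacy: the simplex is compact and the barycentric monomials span all polynomials.\<close>

theorem measure_on_simplex_eqI:
  fixes M N :: "(real ^ 'n::finite) measure"
  assumes fin: "finite_measure M" "finite_measure N"
    and sets: "sets M = sets borel" "sets N = sets borel"
    and S: "AE x in M. x \<in> unit_simplex" "AE x in N. x \<in> unit_simplex"
    and eq: "\<And>\<alpha>. (LINT x|M. bary_monomial \<alpha> x) = (LINT x|N. bary_monomial \<alpha> x)"
  shows "M = N"
proof (rule measure_eq_if_polynomial_integrals_eq[OF fin sets compact_unit_simplex S])
  fix q :: "real^'n \<Rightarrow> real" assume "real_polynomial_function q"
  then have "bary_polynomial q" by (rule real_polynomial_function_imp_bary_polynomial)
  then have "integrable M q \<and> integrable N q \<and> (LINT x|M. q x) = (LINT x|N. q x)"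
  proof induction
    case (monomial c \<alpha>)
    interpret M: finite_measure M by fact
    interpret N: finite_measure N by fact
    have [measurable_cong]: "sets M = sets borel" "sets N = sets borel" by (fact sets)+
    have "integrable M (bary_monomial \<alpha>)"
      using S(1) bary_monomial_bounds[of _ \<alpha>]
      by (intro M.integrable_const_bound[of _ 1]) (auto elim!: eventually_mono)
    moreover have "integrable N (bary_monomial \<alpha>)"
      using S(2) bary_monomial_bounds[of _ \<alpha>]
      by (intro N.integrable_const_bound[of _ 1]) (auto elim!: eventually_mono)
    ultimately show ?case by (simp add: eq)
  qed auto
  then show "(LINT x|M. q x) = (LINT x|N. q x)" by simp
qed

section \<open>The action of the chain on Bernstein polynomials\<close>

text \<open>Induction on \<open>a\<close>. With \<open>u = t * y + (1 - t)\<close> one has \<open>t * (y - 1) = u - 1\<close>, so the derivative of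
\<open>t ^ (r + 1) * u ^ (a + 1)\<close> is \<open>(r + a + 2) * t ^ r * u ^ (a + 1) - (a + 1) * t ^ r * u ^ a\<close>, which
reduces the exponent of \<open>u\<close> by one.\<close>

lemma has_integral_segment_power:
  fixes y :: real
  shows "((\<lambda>t. t ^ r * (t * y + (1 - t)) ^ a) has_integral
           (\<Sum>k\<le>a. fact a * fact (r + k) / (fact (r + a) * fact k) * y ^ k) / (real (r + a) + 1)) {0..1}"
proof (induction a)
  case 0
  have "((\<lambda>t. t ^ Suc r / (real r + 1)) has_real_derivative t ^ r) (at t within {0..1})" for t
    by (rule DERIV_cong[OF DERIV_cdivide[OF DERIV_pow]]) (simp add: field_simps)
  then have "((\<lambda>t. t ^ r) has_integral (1 ^ Suc r / (real r + 1) - 0 ^ Suc r / (real r + 1))) {0..1::real}"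
    by (intro fundamental_theorem_of_calculus)
       (auto simp: has_real_derivative_iff_has_vector_derivative[symmetric])
  then show ?case by simp
next
  case (Suc a)
  let ?J = "\<lambda>a. (\<Sum>k\<le>a. fact a * fact (r + k) / (fact (r + a) * fact k) * y ^ k)"
  define c where "c = real (r + a) + 2"
  define F where "F = (\<lambda>t. t ^ Suc r * (t * y + (1 - t)) ^ Suc a / c)"
  have c: "c > 0" by (simp add: c_def)
  have "(F has_real_derivative
           t ^ r * (t * y + (1 - t)) ^ Suc a - (real a + 1) / c * (t ^ r * (t * y + (1 - t)) ^ a)) (at t within {0..1})" for t
  proof -
    have "((1 + real r) * t ^ r * u ^ Suc a + t ^ Suc r * ((1 + real a) * u ^ a * (y - 1))) / c
        = t ^ r * u ^ Suc a - (real a + 1) / c * (t ^ r * u ^ a)" if u: "u = t * y + (1 - t)" for u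
    proof -
      have "t * (y - 1) = u - 1" by (simp add: u algebra_simps)
      then have "(1 + real r) * t ^ r * u ^ Suc a + t ^ Suc r * ((1 + real a) * u ^ a * (y - 1))
          = (1 + real r) * t ^ r * u ^ Suc a + t ^ r * ((1 + real a) * u ^ a * (u - 1))"
        by (simp add: mult.assoc mult.left_commute)
      also have "\<dots> = c * (t ^ r * u ^ Suc a) - (real a + 1) * (t ^ r * u ^ a)"
        by (simp add: c_def algebra_simps)
      finally show ?thesis using c by (simp add: field_simps)
    qed
    note eq = this[OF refl]
    have u: "((\<lambda>t. t * y + (1 - t)) has_real_derivative (y - 1)) (at t within {0..1})"
      by (auto intro!: derivative_eq_intros)
    show ?thesis
      unfolding F_def eq[symmetric]
      by (rule DERIV_cong[OF DERIV_cdivide[OF DERIV_mult[OF DERIV_power_Suc[OF DERIV_ident] DERIV_power_Suc[OF u]]]])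
         (simp only: mult.commute mult.left_commute mult_1_right mult_1_left of_nat_Suc)
  qed
  then have "((\<lambda>t. t ^ r * (t * y + (1 - t)) ^ Suc a - (real a + 1) / c * (t ^ r * (t * y + (1 - t)) ^ a))
               has_integral F 1 - F 0) {0..1}"
    by (intro fundamental_theorem_of_calculus)
       (auto simp: has_real_derivative_iff_has_vector_derivative[symmetric])
  from has_integral_add[OF this has_integral_mult_right[OF Suc, of "(real a + 1) / c"]]
  have "((\<lambda>t. t ^ r * (t * y + (1 - t)) ^ Suc a) has_integral
          F 1 - F 0 + (real a + 1) / c * (?J a / (real (r + a) + 1))) {0..1}"
    by simp
  moreover have "F 1 - F 0 + (real a + 1) / c * (?J a / (real (r + a) + 1)) = ?J (Suc a) / (real (r + Suc a) + 1)"
  proof -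
    have X: "(real a + 1) * (?J a / (real (r + a) + 1))
        = (\<Sum>k\<le>a. fact (Suc a) * fact (r + k) / (fact (r + Suc a) * fact k) * y ^ k)"
      unfolding sum_divide_distrib sum_distrib_left
      by (intro sum.cong) (auto simp: field_simps)
    have "F 1 - F 0 = y ^ Suc a / c" by (simp add: F_def)
    moreover have "?J (Suc a) = (\<Sum>k\<le>a. fact (Suc a) * fact (r + k) / (fact (r + Suc a) * fact k) * y ^ k) + y ^ Suc a"
      by (simp del: fact_Suc)
    moreover have "real (r + Suc a) + 1 = c" by (simp add: c_def)
    ultimately show ?thesis
      unfolding X[symmetric] by (simp only: add_divide_distrib[of "y ^ Suc a"] add.commute times_divide_eq_left)
  qed
  ultimately show ?case by simp
qed

text \<open>With the multinomial coefficient as normalisation, averaging over a segment to a vertex has only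
coefficients 1; see \<open>LINT_bernstein_poly_segment\<close>.\<close>

definition bernstein_poly :: "('n::finite option \<Rightarrow> nat) \<Rightarrow> real ^ 'n \<Rightarrow> real" where
  "bernstein_poly \<alpha> x = fact (\<Sum>i\<in>UNIV. \<alpha> i) / (\<Prod>i\<in>UNIV. fact (\<alpha> i)) * bary_monomial \<alpha> x"

lemma bernstein_poly_0 [simp]: "bernstein_poly (\<lambda>_. 0) x = 1"
  by (simp add: bernstein_poly_def)

lemma sum_fun_upd_split:
  fixes \<alpha> :: "'i::finite \<Rightarrow> nat"
  shows "(\<Sum>j\<in>UNIV. (\<alpha>(i := k)) j) = (\<Sum>j\<in>-{i}. \<alpha> j) + k"
proof -
  have "(\<Sum>j\<in>UNIV. (\<alpha>(i := k)) j) = k + (\<Sum>j\<in>UNIV-{i}. (\<alpha>(i := k)) j)"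
    by (subst sum.remove[of _ i]) auto
  also have "(\<Sum>j\<in>UNIV-{i}. (\<alpha>(i := k)) j) = (\<Sum>j\<in>-{i}. \<alpha> j)"
    by (intro sum.cong) auto
  finally show ?thesis by simp
qed

lemma sum_split_at: "(\<Sum>j\<in>UNIV. \<alpha> j) = (\<Sum>j\<in>-{i}. \<alpha> j) + \<alpha> i" for \<alpha> :: "'i::finite \<Rightarrow> nat"
  using sum_fun_upd_split[of \<alpha> i "\<alpha> i"] by simp

lemma prod_split_at:
  "(\<Prod>j\<in>UNIV. f j) = f i * (\<Prod>j\<in>-{i}. f j)" for f :: "'i::finite \<Rightarrow> 'b::comm_monoid_mult"
  by (subst prod.remove[of _ i]) (auto simp: Compl_eq_Diff_UNIV)

text \<open>Isolates the dependence on the exponent of one coordinate, which is the only exponent that the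
chain changes when it moves towards the corresponding vertex.\<close>

lemma bernstein_poly_fun_upd:
  "bernstein_poly (\<alpha>(i := k)) x =
     fact ((\<Sum>j\<in>-{i}. \<alpha> j) + k) / (fact k * (\<Prod>j\<in>-{i}. fact (\<alpha> j))) *
       (bary_coord x i ^ k * (\<Prod>j\<in>-{i}. bary_coord x j ^ \<alpha> j))"
proof -
  have "(\<Prod>j\<in>UNIV. fact ((\<alpha>(i := k)) j)) = (fact k * (\<Prod>j\<in>-{i}. fact (\<alpha> j)) :: real)"
    by (subst prod_split_at[of _ i]) auto
  moreover have "(\<Prod>j\<in>UNIV. bary_coord x j ^ ((\<alpha>(i := k)) j)) =
      bary_coord x i ^ k * (\<Prod>j\<in>-{i}. bary_coord x j ^ \<alpha> j)"
    by (subst prod_split_at[of _ i]) auto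
  ultimately show ?thesis
    unfolding bernstein_poly_def bary_monomial_def sum_fun_upd_split by simp
qed

lemma bary_coord_segment:
  "bary_coord (t *\<^sub>R x + (1 - t) *\<^sub>R simplex_vertex i) j = t * bary_coord x j + (if j = i then 1 - t else 0)"
proof (cases j)
  case None
  have "(\<Sum>k\<in>UNIV. simplex_vertex i $ k) = (if i = None then 0 else (1::real))"
    by (auto simp: simplex_vertex_def axis_def split: option.splits)
  then show ?thesis
    using None by (auto simp: bary_coord_def sum.distrib sum_distrib_left[symmetric]) (auto simp: algebra_simps)
next
  case (Some k)
  then show ?thesis
    by (auto simp: bary_coord_def simplex_vertex_def axis_def split: option.splits)
qed

text \<open>Moving to the vertex \<open>i\<close> multiplies every other barycentric coordinate by \<open>t\<close> and turns the
\<open>i\<close>-th coordinate \<open>y\<close> into \<open>t * y + (1 - t)\<close>. What remains is the one-variable integral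
\<open>has_integral_segment_power\<close>, whose factorials combine with the multinomial coefficients.\<close>

lemma LINT_bernstein_poly_segment:
  fixes x :: "real ^ 'n::finite"
  shows "(LINT t:{0..1}|lborel. bernstein_poly \<alpha> (t *\<^sub>R x + (1 - t) *\<^sub>R simplex_vertex i)) =
    (\<Sum>k\<le>\<alpha> i. bernstein_poly (\<alpha>(i := k)) x) / (real (\<Sum>j\<in>UNIV. \<alpha> j) + 1)"
proof -
  define r where "r = (\<Sum>j\<in>-{i}. \<alpha> j)"
  define R where "R = (\<Prod>j\<in>-{i}. bary_coord x j ^ \<alpha> j)"
  define Q :: real where "Q = (\<Prod>j\<in>-{i}. fact (\<alpha> j))"
  define y where "y = bary_coord x i"
  define C where "C = fact (r + \<alpha> i) / (fact (\<alpha> i) * Q) * R"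
  have n: "(\<Sum>j\<in>UNIV. \<alpha> j) = r + \<alpha> i" unfolding r_def by (rule sum_split_at)
  have seg: "bernstein_poly \<alpha> (t *\<^sub>R x + (1 - t) *\<^sub>R simplex_vertex i) =
      C * (t ^ r * (t * y + (1 - t)) ^ \<alpha> i)" for t
  proof -
    have "(\<Prod>j\<in>-{i}. bary_coord (t *\<^sub>R x + (1 - t) *\<^sub>R simplex_vertex i) j ^ \<alpha> j) = (\<Prod>j\<in>-{i}. (t * bary_coord x j) ^ \<alpha> j)"
      by (intro prod.cong) (auto simp: bary_coord_segment)
    also have "\<dots> = t ^ r * R"
      unfolding r_def R_def by (simp add: power_mult_distrib prod.distrib power_sum)
    finally have "(\<Prod>j\<in>-{i}. bary_coord (t *\<^sub>R x + (1 - t) *\<^sub>R simplex_vertex i) j ^ \<alpha> j) = t ^ r * R" .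
    then show ?thesis
      using bernstein_poly_fun_upd[of \<alpha> i "\<alpha> i" "t *\<^sub>R x + (1 - t) *\<^sub>R simplex_vertex i"]
      by (simp add: bary_coord_segment C_def y_def r_def Q_def)
  qed
  have "set_integrable lborel {0..1} (\<lambda>t. C * (t ^ r * (t * y + (1 - t)) ^ \<alpha> i))"
    unfolding set_integrable_def by (intro borel_integrable_compact continuous_intros) auto
  from set_borel_integral_eq_integral(2)[OF this]
  have "(LINT t:{0..1}|lborel. C * (t ^ r * (t * y + (1 - t)) ^ \<alpha> i)) =
      C * ((\<Sum>k\<le>\<alpha> i. fact (\<alpha> i) * fact (r + k) / (fact (r + \<alpha> i) * fact k) * y ^ k) / (real (r + \<alpha> i) + 1))"
    by (rule trans) (intro integral_unique has_integral_mult_right has_integral_segment_power)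
  also have "\<dots> = (\<Sum>k\<le>\<alpha> i. bernstein_poly (\<alpha>(i := k)) x) / (real (r + \<alpha> i) + 1)"
  proof -
    have "C * (fact (\<alpha> i) * fact (r + k) / (fact (r + \<alpha> i) * fact k) * y ^ k) = bernstein_poly (\<alpha>(i := k)) x" for k
      unfolding bernstein_poly_fun_upd C_def r_def R_def[symmetric] Q_def[symmetric] y_def[symmetric]
      by (simp add: ac_simps)
    then show ?thesis by (simp only: times_divide_eq_right sum_distrib_left)
  qed
  finally show ?thesis by (simp only: seg n)
qed

lemma bary_coord_mult_bernstein_poly:
  "bary_coord x i * bernstein_poly (\<alpha>(i := k)) x =
     real (Suc k) / real ((\<Sum>j\<in>-{i}. \<alpha> j) + Suc k) * bernstein_poly (\<alpha>(i := Suc k)) x"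
  unfolding bernstein_poly_fun_upd by (simp add: divide_simps del: of_nat_Suc)

text \<open>The weights of the theorem, in a form that treats the vertex 0 like the other vertices.\<close>

definition affine_weight :: "('n::finite option \<Rightarrow> real) \<Rightarrow> 'n option \<Rightarrow> real ^ 'n \<Rightarrow> real" where
  "affine_weight \<theta> i x = \<theta> i + (1 - (\<Sum>j\<in>UNIV. \<theta> j)) * bary_coord x i"

lemma sum_affine_weight: "(\<Sum>i\<in>UNIV. affine_weight \<theta> i x) = 1"
  by (simp add: affine_weight_def sum.distrib sum_distrib_left[symmetric] sum_bary_coord)

text \<open>The coefficients, up to the factor \<open>1 / (n + 1)\<close>, of the lower-degree terms in the image of a
Bernstein polynomial of degree \<open>n\<close> under the transition operator. For \<open>k = 0\<close> the
fraction is 0, also when its denominator vanishes, by the convention \<open>0 / 0 = 0\<close>.\<close>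

definition moment_coeff :: "('n::finite option \<Rightarrow> real) \<Rightarrow> ('n option \<Rightarrow> nat) \<Rightarrow> 'n option \<Rightarrow> nat \<Rightarrow> real" where
  "moment_coeff \<theta> \<alpha> i k = \<theta> i + (1 - (\<Sum>j\<in>UNIV. \<theta> j)) * (real k / real ((\<Sum>j\<in>-{i}. \<alpha> j) + k))"

text \<open>Multiplication by a barycentric coordinate raises one exponent, so the affine part of the weight
shifts the sum over \<open>k\<close> by one; the top term \<open>k = \<alpha> i\<close> of the shifted sum joins the multiple
of \<open>bernstein_poly \<alpha>\<close>.\<close>

lemma affine_weight_mult_sum_bernstein_poly:
  "affine_weight \<theta> i x * (\<Sum>k\<le>\<alpha> i. bernstein_poly (\<alpha>(i := k)) x) =
     (affine_weight \<theta> i x + (1 - (\<Sum>j\<in>UNIV. \<theta> j)) * (real (\<alpha> i) / real (\<Sum>j\<in>UNIV. \<alpha> j))) * bernstein_poly \<alpha> x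
     + (\<Sum>k<\<alpha> i. moment_coeff \<theta> \<alpha> i k * bernstein_poly (\<alpha>(i := k)) x)"
proof -
  define r where "r = (\<Sum>j\<in>-{i}. \<alpha> j)"
  define c where "c = 1 - (\<Sum>j\<in>UNIV. \<theta> j)"
  define b where "b = (\<lambda>k. bernstein_poly (\<alpha>(i := k)) x)"
  have n: "(\<Sum>j\<in>UNIV. \<alpha> j) = r + \<alpha> i" unfolding r_def by (rule sum_split_at)
  have b: "b (\<alpha> i) = bernstein_poly \<alpha> x" by (simp add: b_def)
  have split: "{..a} = insert a {..<a}" for a :: nat by auto
  have "(\<Sum>k<\<alpha> i. bary_coord x i * b k) = (\<Sum>k<\<alpha> i. real (Suc k) / real (r + Suc k) * b (Suc k))"
    unfolding b_def r_def by (simp only: bary_coord_mult_bernstein_poly)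
  also have "\<dots> = (\<Sum>k\<le>\<alpha> i. real k / real (r + k) * b k)"
    using sum.lessThan_Suc_shift[of "\<lambda>k. real k / real (r + k) * b k" "\<alpha> i"]
    by (simp add: lessThan_Suc_atMost del: sum.lessThan_Suc)
  also have "\<dots> = real (\<alpha> i) / real (r + \<alpha> i) * b (\<alpha> i) + (\<Sum>k<\<alpha> i. real k / real (r + k) * b k)"
    by (simp add: split)
  finally have s: "(\<Sum>k<\<alpha> i. bary_coord x i * b k) =
    real (\<alpha> i) / real (r + \<alpha> i) * b (\<alpha> i) + (\<Sum>k<\<alpha> i. real k / real (r + k) * b k)" .
  have "affine_weight \<theta> i x * (\<Sum>k\<le>\<alpha> i. b k) =
      affine_weight \<theta> i x * b (\<alpha> i) + (\<theta> i * (\<Sum>k<\<alpha> i. b k) + c * (\<Sum>k<\<alpha> i. bary_coord x i * b k))"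
    by (simp add: split affine_weight_def c_def[symmetric] sum_distrib_left[symmetric]) (simp add: algebra_simps)
  also have "\<dots> = (affine_weight \<theta> i x + c * (real (\<alpha> i) / real (r + \<alpha> i))) * b (\<alpha> i)
      + (\<Sum>k<\<alpha> i. moment_coeff \<theta> \<alpha> i k * b k)"
    unfolding s moment_coeff_def r_def[symmetric] c_def[symmetric]
    by (simp add: sum.distrib sum_distrib_left algebra_simps)
  finally show ?thesis unfolding n c_def b by (simp add: b_def)
qed

text \<open>The transition operator is triangular on Bernstein polynomials, with diagonal entry
\<open>(2 - |\<theta>|) / (n + 1)\<close> in degree \<open>n > 0\<close>: the weights contribute \<open>1\<close>, and the shifted top terms
contribute \<open>(1 - |\<theta>|) * (\<alpha> i / n)\<close> each, which sum to \<open>1 - |\<theta>|\<close>.\<close>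

lemma df_operator_bernstein_poly:
  assumes "x \<in> unit_simplex"
    and p: "\<And>i y. y \<in> unit_simplex \<Longrightarrow> p i y = affine_weight \<theta> i y"
    and \<alpha>: "(\<Sum>j\<in>UNIV. \<alpha> j) \<noteq> 0"
  shows "df_operator p (bernstein_poly \<alpha>) x =
    ((2 - (\<Sum>j\<in>UNIV. \<theta> j)) * bernstein_poly \<alpha> x
       + (\<Sum>i\<in>UNIV. \<Sum>k<\<alpha> i. moment_coeff \<theta> \<alpha> i k * bernstein_poly (\<alpha>(i := k)) x))
    / (real (\<Sum>j\<in>UNIV. \<alpha> j) + 1)"
proof -
  define c where "c = 1 - (\<Sum>j\<in>UNIV. \<theta> j)"
  have "df_operator p (bernstein_poly \<alpha>) x =
      (\<Sum>i\<in>UNIV. affine_weight \<theta> i x * (\<Sum>k\<le>\<alpha> i. bernstein_poly (\<alpha>(i := k)) x)) / (real (\<Sum>j\<in>UNIV. \<alpha> j) + 1)"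
    using assms(1) by (simp only: df_operator_def LINT_bernstein_poly_segment p sum_divide_distrib[of _ UNIV]
      times_divide_eq_right)
  also have "(\<Sum>i\<in>UNIV. affine_weight \<theta> i x * (\<Sum>k\<le>\<alpha> i. bernstein_poly (\<alpha>(i := k)) x)) =
     (\<Sum>i\<in>UNIV. affine_weight \<theta> i x + c * (real (\<alpha> i) / real (\<Sum>j\<in>UNIV. \<alpha> j))) * bernstein_poly \<alpha> x
     + (\<Sum>i\<in>UNIV. \<Sum>k<\<alpha> i. moment_coeff \<theta> \<alpha> i k * bernstein_poly (\<alpha>(i := k)) x)"
    unfolding affine_weight_mult_sum_bernstein_poly
    by (subst sum.distrib) (simp only: c_def sum_distrib_right)
  also have "(\<Sum>i\<in>UNIV. affine_weight \<theta> i x + c * (real (\<alpha> i) / real (\<Sum>j\<in>UNIV. \<alpha> j))) = 2 - (\<Sum>j\<in>UNIV. \<theta> j)"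
    using \<alpha> by (simp add: sum.distrib sum_affine_weight sum_distrib_left[symmetric] sum_divide_distrib[symmetric] c_def del: sum_eq_0_iff flip: of_nat_sum)
  finally show ?thesis .
qed

section \<open>The recurrence for the moments\<close>

text \<open>The integral of \<open>bernstein_poly \<alpha>\<close> against the Dirichlet distribution.\<close>

definition dirichlet_moment :: "('n::finite option \<Rightarrow> real) \<Rightarrow> ('n option \<Rightarrow> nat) \<Rightarrow> real" where
  "dirichlet_moment \<theta> \<alpha> = fact (\<Sum>i\<in>UNIV. \<alpha> i) / pochhammer (\<Sum>i\<in>UNIV. \<theta> i) (\<Sum>i\<in>UNIV. \<alpha> i) *
     (\<Prod>i\<in>UNIV. pochhammer (\<theta> i) (\<alpha> i) / fact (\<alpha> i))"

text \<open>The sum telescopes. The identities \<open>(k + 1) * b (k + 1) = (\<theta> i + k) * b k\<close> and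
\<open>c (m + 1) * (|\<theta>| + m) / (m + 1) = c m\<close> for the factors \<open>b\<close> and \<open>c\<close> of a Dirichlet moment
show that the summands are the increments of the function \<open>G\<close> in the proof.\<close>

lemma sum_moment_coeff_dirichlet_moment:
  fixes \<theta> :: "'n::finite option \<Rightarrow> real"
  assumes pos: "\<And>i. \<theta> i > 0" and \<alpha>: "(\<Sum>j\<in>UNIV. \<alpha> j) \<noteq> 0"
  shows "(\<Sum>k<\<alpha> i. moment_coeff \<theta> \<alpha> i k * dirichlet_moment \<theta> (\<alpha>(i := k))) =
    real (\<alpha> i) / real (\<Sum>j\<in>UNIV. \<alpha> j) * (real (\<Sum>j\<in>UNIV. \<alpha> j) - 1 + (\<Sum>j\<in>UNIV. \<theta> j)) * dirichlet_moment \<theta> \<alpha>"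
proof -
  define r where "r = (\<Sum>j\<in>-{i}. \<alpha> j)"
  define T where "T = (\<Sum>j\<in>UNIV. \<theta> j)"
  define R where "R = (\<Prod>j\<in>-{i}. pochhammer (\<theta> j) (\<alpha> j) / fact (\<alpha> j))"
  define b where "b = (\<lambda>k. pochhammer (\<theta> i) k / fact k)"
  define c where "c = (\<lambda>k. fact k / pochhammer T k)"
  (* The discrete primitive of the summands; it vanishes at 0. *)
  define G where "G = (\<lambda>k. real k * b k * c (r + k) * (T + real (r + k) - 1) / real (r + k) * R)"
  have T: "T > 0" unfolding T_def by (intro sum_pos pos) auto
  have n: "(\<Sum>j\<in>UNIV. \<alpha> j) = r + \<alpha> i" unfolding r_def by (rule sum_split_at)
  have D: "dirichlet_moment \<theta> (\<alpha>(i := k)) = c (r + k) * b k * R" for k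
  proof -
    have "(\<Prod>j\<in>UNIV. pochhammer (\<theta> j) ((\<alpha>(i := k)) j) / fact ((\<alpha>(i := k)) j)) = b k * R"
      unfolding b_def R_def by (subst prod_split_at[of _ i]) auto
    then show ?thesis unfolding dirichlet_moment_def sum_fun_upd_split c_def T_def r_def by simp
  qed
  have step: "moment_coeff \<theta> \<alpha> i k * dirichlet_moment \<theta> (\<alpha>(i := k)) = G (Suc k) - G k" for k
  proof -
    have b: "real (Suc k) * b (Suc k) = (\<theta> i + real k) * b k"
      by (simp add: b_def pochhammer_Suc)
    have c: "c (r + Suc k) * (T + real (r + Suc k) - 1) / real (r + Suc k) = c (r + k)"
      using T by (simp add: c_def pochhammer_Suc add_nonneg_pos divide_simps) 
    have "G (Suc k) = (real (Suc k) * b (Suc k)) * (c (r + Suc k) * (T + real (r + Suc k) - 1) / real (r + Suc k)) * R"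
      unfolding G_def by (simp only: mult.assoc times_divide_eq_right times_divide_eq_left)
    also have "\<dots> = (\<theta> i + real k) * b k * c (r + k) * R" by (simp only: b c)
    finally have GS: "G (Suc k) = (\<theta> i + real k) * b k * c (r + k) * R" .
    show ?thesis
    (* For r + k = 0 both fractions with this denominator are 0 / 0 = 0. *)
    proof (cases "r + k = 0")
      case True
      then show ?thesis unfolding GS D by (simp add: moment_coeff_def G_def)
    next
      case False
      then have "real (r + k) \<noteq> 0" unfolding of_nat_eq_0_iff .
      then show ?thesis
        unfolding GS unfolding D moment_coeff_def T_def[symmetric] r_def[symmetric] G_def
        by (simp add: divide_simps del: of_nat_add) (simp add: algebra_simps del: of_nat_add)
    qed
  qed
  have "(\<Sum>k<\<alpha> i. moment_coeff \<theta> \<alpha> i k * dirichlet_moment \<theta> (\<alpha>(i := k))) = G (\<alpha> i) - G 0"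
    unfolding step by (rule sum_lessThan_telescope)
  also have "\<dots> = real (\<alpha> i) / real (r + \<alpha> i) * (real (r + \<alpha> i) - 1 + T) * (c (r + \<alpha> i) * b (\<alpha> i) * R)"
    by (simp add: G_def algebra_simps)
  also have "c (r + \<alpha> i) * b (\<alpha> i) * R = dirichlet_moment \<theta> \<alpha>" using D[of "\<alpha> i"] by simp
  finally show ?thesis unfolding n T_def .
qed

lemma dirichlet_moment_recurrence:
  fixes \<theta> :: "'n::finite option \<Rightarrow> real"
  assumes pos: "\<And>i. \<theta> i > 0" and \<alpha>: "(\<Sum>j\<in>UNIV. \<alpha> j) \<noteq> 0"
  shows "(\<Sum>i\<in>UNIV. \<Sum>k<\<alpha> i. moment_coeff \<theta> \<alpha> i k * dirichlet_moment \<theta> (\<alpha>(i := k))) =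
    (real (\<Sum>j\<in>UNIV. \<alpha> j) - 1 + (\<Sum>j\<in>UNIV. \<theta> j)) * dirichlet_moment \<theta> \<alpha>"
  using \<alpha> unfolding sum_moment_coeff_dirichlet_moment[OF assms]
  by (simp add: sum_distrib_right[symmetric] sum_divide_distrib[symmetric] del: sum_eq_0_iff flip: of_nat_sum)

text \<open>The factor \<open>n - 1 + |\<theta>|\<close> is positive for \<open>n > 0\<close>, so the recurrence determines every moment
from those of smaller degree, and ultimately from the total mass.\<close>

lemma moments_eq_dirichlet_moment:
  fixes \<theta> :: "'n::finite option \<Rightarrow> real" and M :: "('n option \<Rightarrow> nat) \<Rightarrow> real"
  assumes pos: "\<And>i. \<theta> i > 0" and M0: "M (\<lambda>_. 0) = 1"
    and rec: "\<And>\<alpha>. (\<Sum>j\<in>UNIV. \<alpha> j) \<noteq> 0 \<Longrightarrow>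
      (\<Sum>i\<in>UNIV. \<Sum>k<\<alpha> i. moment_coeff \<theta> \<alpha> i k * M (\<alpha>(i := k))) =
        (real (\<Sum>j\<in>UNIV. \<alpha> j) - 1 + (\<Sum>j\<in>UNIV. \<theta> j)) * M \<alpha>"
  shows "M \<alpha> = dirichlet_moment \<theta> \<alpha>"
proof (induction "\<Sum>j\<in>UNIV. \<alpha> j" arbitrary: \<alpha> rule: less_induct)
  case less
  show ?case
  proof (cases "(\<Sum>j\<in>UNIV. \<alpha> j) = 0")
    case True
    then have "\<alpha> = (\<lambda>_. 0)" by auto
    then show ?thesis by (simp add: M0 dirichlet_moment_def)
  next
    case False
    have "M (\<alpha>(i := k)) = dirichlet_moment \<theta> (\<alpha>(i := k))" if "k < \<alpha> i" for i k
      using that by (intro less) (simp only: sum_fun_upd_split sum_split_at[of \<alpha> i])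
    then have "(\<Sum>i\<in>UNIV. \<Sum>k<\<alpha> i. moment_coeff \<theta> \<alpha> i k * M (\<alpha>(i := k))) =
        (\<Sum>i\<in>UNIV. \<Sum>k<\<alpha> i. moment_coeff \<theta> \<alpha> i k * dirichlet_moment \<theta> (\<alpha>(i := k)))"
      by (intro sum.cong) auto
    moreover have "(\<Sum>j\<in>UNIV. \<theta> j) > 0" by (intro sum_pos pos) auto
    moreover have "real (\<Sum>j\<in>UNIV. \<alpha> j) \<ge> 1" using False by linarith
    ultimately show ?thesis
      unfolding rec[OF False] dirichlet_moment_recurrence[OF pos False] by simp
  qed
qed

section \<open>The Dirichlet integral\<close>

lemma nn_integral_Beta_scaled:
  fixes a c s :: real
  assumes "a > 0" "c > 0"
  shows "(\<integral>\<^sup>+y. ennreal (y powr (a - 1) * indicator {0..} y * (indicator {0..} (s - y) * (s - y) powr (c - 1))) \<partial>lborel) =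
    ennreal (indicator {0..} s * s powr (a + c - 1) * Beta a c)" (is "(\<integral>\<^sup>+y. ennreal (?f y) \<partial>lborel) = _")
proof (cases "s > 0")
  case False
  have "?f y = 0" for y using False by (cases "y = 0") (auto simp: indicator_def)
  then have "(\<integral>\<^sup>+y. ennreal (?f y) \<partial>lborel) = 0" by (simp only: ennreal_0) simp
  moreover have "indicator {0..} s * s powr (a + c - 1) = 0" using False by (auto simp: indicator_def)
  ultimately show ?thesis by (simp only: mult_zero_left ennreal_0)
next
  case s: True
  have unit: "(\<integral>\<^sup>+u. ennreal (u powr (a - 1) * (1 - u) powr (c - 1)) * indicator {0..1} u \<partial>lborel) = ennreal (Beta a c)"
    using assms by (intro nn_integral_has_integral_lebesgue' has_integral_Beta_real) auto
  have "(\<integral>\<^sup>+y. ennreal (?f y) \<partial>lborel) = ennreal s * (\<integral>\<^sup>+u. ennreal (?f (s * u)) \<partial>lborel)"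
    using s by (subst nn_integral_real_affine[where c=s and t=0]) auto
  also have "(\<lambda>u. ennreal (?f (s * u))) =
      (\<lambda>u. ennreal (s powr (a + c - 2)) * (ennreal (u powr (a - 1) * (1 - u) powr (c - 1)) * indicator {0..1} u))"
  proof
    fix u
    have *: "s - s * u = s * (1 - u)" by (simp add: algebra_simps)
    show "ennreal (?f (s * u)) =
      ennreal (s powr (a + c - 2)) * (ennreal (u powr (a - 1) * (1 - u) powr (c - 1)) * indicator {0..1} u)"
    proof (cases "0 \<le> u \<and> u \<le> 1")
      case True
      have "s powr (a + c - 2) = s powr (a - 1) * s powr (c - 1)"
        using s by (simp add: powr_add[symmetric])
      then show ?thesis using s True unfolding *
        by (simp add: powr_mult zero_le_mult_iff ac_simps flip: ennreal_mult)
    next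
      case False
      then have "?f (s * u) = 0" using s unfolding * by (auto simp: indicator_def zero_le_mult_iff)
      then show ?thesis using False by (auto simp: indicator_def)
    qed
  qed
  also have "ennreal s * (\<integral>\<^sup>+u. (ennreal (s powr (a + c - 2)) * (ennreal (u powr (a - 1) * (1 - u) powr (c - 1)) * indicator {0..1} u)) \<partial>lborel)
      = ennreal s * (ennreal (s powr (a + c - 2)) * ennreal (Beta a c))"
    by (subst nn_integral_cmult) (simp_all add: unit)
  also have "\<dots> = ennreal (s * s powr (a + c - 2) * Beta a c)"
    using s assms by (simp add: ennreal_mult' mult.assoc)
  also have "s * s powr (a + c - 2) = s powr (a + c - 1)"
    using s powr_mult_base[of s "a + c - 2"] by simp
  finally show ?thesis using s by simp
qed

text \<open>Induction on \<open>I\<close>: integrating over the coordinates in \<open>I\<close> for a fixed value \<open>y\<close> of a further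
coordinate \<open>j\<close> is the same integral for the simplex of size \<open>s - y\<close>, and the remaining integral
over \<open>y\<close> is a Beta integral. The size \<open>s\<close> may be negative, where the indicators make both sides
vanish, so that the induction hypothesis applies for every \<open>y\<close>.\<close>

lemma dirichlet_integral_PiM:
  fixes a :: "'i \<Rightarrow> real" and b s :: real
  assumes "finite I" "\<And>i. a i > 0" "b > 0"
  shows "(\<integral>\<^sup>+x. ennreal ((\<Prod>i\<in>I. x i powr (a i - 1) * indicator {0..} (x i)) *
              ((s - (\<Sum>i\<in>I. x i)) powr (b - 1) * indicator {0..} (s - (\<Sum>i\<in>I. x i)))) \<partial>Pi\<^sub>M I (\<lambda>_. lborel)) =
    ennreal (indicator {0..} s * s powr ((\<Sum>i\<in>I. a i) + b - 1) *
      ((\<Prod>i\<in>I. Gamma (a i)) * Gamma b / Gamma ((\<Sum>i\<in>I. a i) + b)))"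
  using assms(1)
proof (induction I arbitrary: s rule: finite_induct)
  case empty
  have "Gamma b \<noteq> 0" using Gamma_real_pos[OF assms(3)] by simp
  then show ?case by (simp add: PiM_empty nn_integral_count_space_finite mult.commute)
next
  case (insert j I s)
  interpret product_sigma_finite "\<lambda>_. lborel" by standard
  let ?g = "\<lambda>I s x. (\<Prod>i\<in>I. x i powr (a i - 1) * indicator {0..} (x i)) *
              ((s - (\<Sum>i\<in>I. x i)) powr (b - 1) * indicator {0..} (s - (\<Sum>i\<in>I. x i)))"
  have meas [measurable]: "?g J t \<in> borel_measurable (Pi\<^sub>M J (\<lambda>_. lborel))" for J t by measurable
  define A where "A = (\<Sum>i\<in>I. a i) + b"
  define K where "K = (\<Prod>i\<in>I. Gamma (a i)) * Gamma b / Gamma A"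
  have A: "A > 0" unfolding A_def using assms by (intro add_nonneg_pos sum_nonneg) (auto intro: less_imp_le)
  have K: "K \<ge> 0" unfolding K_def using assms A by (auto intro!: prod_nonneg divide_nonneg_nonneg mult_nonneg_nonneg less_imp_le[OF Gamma_real_pos])
  have step: "?g (insert j I) s (x(j := y)) = y powr (a j - 1) * indicator {0..} y * ?g I (s - y) x" for x y
  proof -
    have "(\<Prod>i\<in>I. (x(j := y)) i powr (a i - 1) * indicator {0..} ((x(j := y)) i)) =
          (\<Prod>i\<in>I. x i powr (a i - 1) * indicator {0..} (x i) :: real)"
      using insert by (intro prod.cong) auto
    moreover have "(\<Sum>i\<in>I. (x(j := y)) i) = (\<Sum>i\<in>I. x i)"
      using insert by (intro sum.cong) auto
    ultimately show ?thesis
      using insert by (simp add: algebra_simps)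
  qed
  have "(\<integral>\<^sup>+x. ennreal (?g (insert j I) s x) \<partial>Pi\<^sub>M (insert j I) (\<lambda>_. lborel)) =
      (\<integral>\<^sup>+y. (\<integral>\<^sup>+x. ennreal (?g (insert j I) s (x(j := y))) \<partial>Pi\<^sub>M I (\<lambda>_. lborel)) \<partial>lborel)"
    using insert by (intro product_nn_integral_insert_rev) auto
  also have "\<dots> = (\<integral>\<^sup>+y. ennreal (y powr (a j - 1) * indicator {0..} y) * (\<integral>\<^sup>+x. ennreal (?g I (s - y) x) \<partial>Pi\<^sub>M I (\<lambda>_. lborel)) \<partial>lborel)"
    unfolding step by (intro nn_integral_cong) (simp add: ennreal_mult' nn_integral_cmult)
  also have "\<dots> = (\<integral>\<^sup>+y. ennreal (y powr (a j - 1) * indicator {0..} y) *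
       ennreal (indicator {0..} (s - y) * (s - y) powr (A - 1) * K) \<partial>lborel)"
    unfolding insert.IH A_def[symmetric] K_def[symmetric] ..
  also have "\<dots> = (\<integral>\<^sup>+y. ennreal K * ennreal (y powr (a j - 1) * indicator {0..} y *
       (indicator {0..} (s - y) * (s - y) powr (A - 1))) \<partial>lborel)"
    using K by (intro nn_integral_cong) (simp flip: ennreal_mult add: ac_simps)
  also have "\<dots> = ennreal K * ennreal (indicator {0..} s * s powr (a j + A - 1) * Beta (a j) A)"
    using assms(2) A by (subst nn_integral_cmult) (simp_all add: nn_integral_Beta_scaled)
  also have "\<dots> = ennreal (K * (indicator {0..} s * s powr (a j + A - 1) * Beta (a j) A))"
    using K by (simp add: ennreal_mult')
  also have "K * (indicator {0..} s * s powr (a j + A - 1) * Beta (a j) A) =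
     indicator {0..} s * s powr ((\<Sum>i\<in>insert j I. a i) + b - 1) *
      ((\<Prod>i\<in>insert j I. Gamma (a i)) * Gamma b / Gamma ((\<Sum>i\<in>insert j I. a i) + b))"
  proof -
    have "(\<Sum>i\<in>insert j I. a i) + b = a j + A" using insert(1,2) by (simp add: A_def)
    moreover have "Gamma A \<noteq> 0" using Gamma_real_pos[OF A] by simp
    moreover have "(\<Prod>i\<in>insert j I. Gamma (a i)) = Gamma (a j) * (\<Prod>i\<in>I. Gamma (a i))"
      using insert(1,2) by simp
    ultimately show ?thesis
      by (simp only: K_def Beta_def) simp
  qed
  finally show ?case .
qed

lemma prod_powr_bary_coord_nonneg: "0 \<le> (\<Prod>i\<in>UNIV. bary_coord x i powr (a i - 1) * indicator {0..} (bary_coord x i) :: real)"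
  by (intro prod_nonneg) auto

text \<open>The coordinate axes identify Lebesgue measure on the space with the product measure over \<open>Basis\<close>,
where \<open>dirichlet_integral_PiM\<close> applies with \<open>s = 1\<close>; the exponent of the last factor belongs to
the vertex 0.\<close>

theorem dirichlet_integral:
  fixes a :: "'n::finite option \<Rightarrow> real"
  assumes pos: "\<And>i. a i > 0"
  shows "(\<integral>\<^sup>+x. ennreal (\<Prod>i\<in>UNIV. bary_coord x i powr (a i - 1) * indicator {0..} (bary_coord x i))
      \<partial>(lborel :: (real ^ 'n) measure)) =
    ennreal ((\<Prod>i\<in>UNIV. Gamma (a i)) / Gamma (\<Sum>i\<in>UNIV. a i))"
proof -
  let ?e = "\<lambda>i::'n. axis i (1::real)"
  define B where "B = (Basis :: (real ^ 'n) set)"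
  define a' where "a' = (\<lambda>b. a (Some (inv ?e b)))"
  have inj: "inj ?e" by (auto simp: inj_on_def axis_eq_axis)
  have B: "B = range ?e" by (auto simp: B_def Basis_vec_def)
  have a': "a' (?e i) = a (Some i)" for i by (simp add: a'_def inv_f_f[OF inj])
  have bary: "bary_coord (\<Sum>b\<in>B. f b *\<^sub>R b) (Some i) = f (?e i)" for f i
  proof -
    have "(\<Sum>b\<in>B. f b *\<^sub>R b) \<bullet> ?e i = f (?e i)"
      unfolding B_def by (rule inner_sum_left_Basis) (auto simp: Basis_vec_def)
    then show ?thesis by (simp add: bary_coord_def inner_axis)
  qed
  have bary0: "bary_coord (\<Sum>b\<in>B. f b *\<^sub>R b) None = 1 - (\<Sum>b\<in>B. f b)" for f
  proof -
    have "(\<Sum>b\<in>B. f b) = (\<Sum>i\<in>UNIV. bary_coord (\<Sum>b\<in>B. f b *\<^sub>R b) (Some i))"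
      unfolding bary unfolding B by (simp add: sum.reindex[OF inj])
    then show ?thesis by (simp add: bary_coord_def)
  qed
  have sumB: "(\<Sum>b\<in>B. a' b) = (\<Sum>i\<in>UNIV. a (Some i))"
    unfolding B by (simp add: sum.reindex[OF inj] a')
  have prodB: "(\<Prod>b\<in>B. F (a' b) (f b)) = (\<Prod>i\<in>UNIV. F (a (Some i)) (f (?e i)))" for F :: "real \<Rightarrow> real \<Rightarrow> real" and f
    unfolding B by (simp add: prod.reindex[OF inj] a')
  let ?h = "\<lambda>c x. x powr (c - 1) * indicator {0..} x :: real"
  have "(\<integral>\<^sup>+x. ennreal (\<Prod>i\<in>UNIV. ?h (a i) (bary_coord x i)) \<partial>(lborel :: (real ^ 'n) measure)) =
    (\<integral>\<^sup>+f. ennreal (\<Prod>i\<in>UNIV. ?h (a i) (bary_coord (\<Sum>b\<in>B. f b *\<^sub>R b) i)) \<partial>Pi\<^sub>M B (\<lambda>_. lborel))"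
    unfolding B_def by (subst lborel_eq) (simp add: nn_integral_distr)
  also have "\<dots> = (\<integral>\<^sup>+f. ennreal ((\<Prod>b\<in>B. ?h (a' b) (f b)) * ?h (a None) (1 - (\<Sum>b\<in>B. f b))) \<partial>Pi\<^sub>M B (\<lambda>_. lborel))"
    unfolding prodB[of ?h] by (simp only: prod_option_UNIV bary bary0 mult.commute)
  also have "\<dots> = ennreal ((\<Prod>b\<in>B. Gamma (a' b)) * Gamma (a None) / Gamma ((\<Sum>b\<in>B. a' b) + a None))"
    by (subst dirichlet_integral_PiM) (simp_all add: B_def pos a'_def)
  also have "(\<Prod>b\<in>B. Gamma (a' b)) * Gamma (a None) / Gamma ((\<Sum>b\<in>B. a' b) + a None) =
      (\<Prod>i\<in>UNIV. Gamma (a i)) / Gamma (\<Sum>i\<in>UNIV. a i)"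
    unfolding prodB[of "\<lambda>c _. Gamma c"] sumB by (simp add: prod_option_UNIV sum_option_UNIV ac_simps)
  finally show ?thesis .
qed

text \<open>The indicator of the interior may be replaced by the indicator of the closed simplex, which
factorises over the coordinates: at a boundary point some barycentric coordinate vanishes, and
\<open>0 powr a = 0\<close>.\<close>

lemma dirichlet_density_eq:
  "dirichlet_density \<theta> x = Gamma (\<Sum>i\<in>UNIV. \<theta> i) / (\<Prod>i\<in>UNIV. Gamma (\<theta> i)) *
     (\<Prod>i\<in>UNIV. bary_coord x i powr (\<theta> i - 1) * indicator {0..} (bary_coord x i))"
proof -
  have "(\<Prod>i\<in>UNIV. bary_coord x i powr (\<theta> i - 1)) * indicator (interior unit_simplex) x =
     (\<Prod>i\<in>UNIV. bary_coord x i powr (\<theta> i - 1) * indicator {0..} (bary_coord x i))"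
  proof (cases "x \<in> interior unit_simplex")
    case True
    then have "x \<in> unit_simplex" using interior_subset by blast
    then have "0 \<le> bary_coord x i" for i by (simp add: bary_coord_nonneg_iff)
    then show ?thesis using True by simp
  next
    case False
    have "open (\<Inter>i. {x::real^'a. 0 < bary_coord x i})"
      by (intro open_INT ballI open_Collect_less continuous_intros) auto
    moreover have "(\<Inter>i. {x::real^'a. 0 < bary_coord x i}) \<subseteq> unit_simplex"
      by (auto simp: bary_coord_nonneg_iff less_imp_le)
    ultimately have "x \<notin> (\<Inter>i. {x. 0 < bary_coord x i})"
      using False interior_maximal by blast
    then obtain i where i: "bary_coord x i \<le> 0" by (auto simp: not_less)
    then have "(\<Prod>i\<in>UNIV. bary_coord x i powr (\<theta> i - 1) * indicator {0..} (bary_coord x i) :: real) = 0"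
      by (intro prod_zero bexI[of _ i]) (auto simp: indicator_def)
    then show ?thesis using False by simp
  qed
  then show ?thesis by (simp add: dirichlet_density_def mult.assoc)
qed

lemma dirichlet_density_eq_0: "x \<notin> unit_simplex \<Longrightarrow> dirichlet_density \<theta> x = 0"
  using interior_subset by (auto simp: dirichlet_density_def indicator_def)

lemma borel_measurable_dirichlet_density [measurable]: "dirichlet_density \<theta> \<in> borel_measurable borel"
  unfolding dirichlet_density_eq[abs_def] by measurable

lemma dirichlet_density_nonneg:
  assumes "\<And>i. \<theta> i > 0" shows "0 \<le> dirichlet_density \<theta> x"
  unfolding dirichlet_density_eq
  by (intro mult_nonneg_nonneg divide_nonneg_nonneg prod_powr_bary_coord_nonneg prod_nonneg less_imp_le[OF Gamma_real_pos] sum_pos assms) auto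

text \<open>A monomial times the density for \<open>\<theta>\<close> is a multiple of the density for \<open>\<theta> + \<alpha>\<close>, so the moments are
quotients of Dirichlet integrals.\<close>

lemma has_bochner_integral_dirichlet_moment:
  fixes \<theta> :: "'n::finite option \<Rightarrow> real"
  assumes pos: "\<And>i. \<theta> i > 0"
  shows "has_bochner_integral lborel (\<lambda>x. bernstein_poly \<alpha> x * dirichlet_density \<theta> x) (dirichlet_moment \<theta> \<alpha>)"
proof -
  define T where "T = (\<Sum>i\<in>UNIV. \<theta> i)"
  define n where "n = (\<Sum>i\<in>UNIV. \<alpha> i)"
  define C where "C = fact n / (\<Prod>i\<in>UNIV. fact (\<alpha> i)) * (Gamma T / (\<Prod>i\<in>UNIV. Gamma (\<theta> i)))"
  define a where "a = (\<lambda>i. \<theta> i + real (\<alpha> i))"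
  have T: "T > 0" unfolding T_def by (intro sum_pos pos) auto
  have a: "a i > 0" for i using pos[of i] by (simp add: a_def add_pos_nonneg)
  have sum_a: "(\<Sum>i\<in>UNIV. a i) = T + real n" by (simp add: a_def T_def n_def sum.distrib)
  have Gpos: "Gamma (\<theta> i) > 0" for i using pos by (rule Gamma_real_pos)
  have C: "C \<ge> 0" unfolding C_def
    by (intro mult_nonneg_nonneg divide_nonneg_nonneg prod_nonneg less_imp_le[OF Gpos] less_imp_le[OF Gamma_real_pos[OF T]]) auto
  let ?h = "\<lambda>a x. (\<Prod>i\<in>UNIV. bary_coord x i powr (a i - 1) * indicator {0..} (bary_coord x i))"
  (* Holds on the whole space: where a coordinate is not positive, both sides vanish. *)
  have eq: "bernstein_poly \<alpha> x * dirichlet_density \<theta> x = C * ?h a x" for x :: "real ^ 'n"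
  proof -
    have "y ^ k * (y powr (t - 1) * indicator {0..} y) = y powr (t + real k - 1) * indicator {0..} y" for y t :: real and k
    proof (cases "y > 0")
      case True
      then show ?thesis by (simp add: powr_realpow[symmetric] powr_add[symmetric] algebra_simps)
    qed (auto simp: indicator_def)
    then have "bary_monomial \<alpha> x * ?h \<theta> x = ?h a x"
      unfolding bary_monomial_def prod.distrib[symmetric] a_def by (simp only:)
    then show ?thesis
      by (simp only: bernstein_poly_def dirichlet_density_eq C_def n_def T_def mult.assoc mult.left_commute)
  qed
  have "(\<integral>\<^sup>+x. ennreal (C * ?h a x) \<partial>(lborel :: (real ^ 'n) measure)) =
      ennreal (C * ((\<Prod>i\<in>UNIV. Gamma (a i)) / Gamma (\<Sum>i\<in>UNIV. a i)))"
    using C by (simp only: ennreal_mult' prod_powr_bary_coord_nonneg) (subst nn_integral_cmult; simp add: dirichlet_integral[OF a] )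
  also have "C * ((\<Prod>i\<in>UNIV. Gamma (a i)) / Gamma (\<Sum>i\<in>UNIV. a i)) = dirichlet_moment \<theta> \<alpha>"
  proof -
    have "t \<notin> \<int>\<^sub>\<le>\<^sub>0" if "t > 0" for t :: real
      using that by (auto elim!: nonpos_Ints_cases)
    then have poch: "pochhammer t k = Gamma (t + real k) / Gamma t" if "t > 0" for t k
      using that by (simp add: pochhammer_Gamma)
    have "(\<Prod>i\<in>UNIV. pochhammer (\<theta> i) (\<alpha> i) / fact (\<alpha> i)) =
      (\<Prod>i\<in>UNIV. Gamma (a i)) / (\<Prod>i\<in>UNIV. Gamma (\<theta> i)) / (\<Prod>i\<in>UNIV. fact (\<alpha> i))"
      by (simp add: poch pos a_def prod_dividef prod.distrib)
    then show ?thesis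
      unfolding dirichlet_moment_def sum_a C_def T_def[symmetric] n_def[symmetric] poch[OF T]
      by simp
  qed
  finally have "(\<integral>\<^sup>+x. ennreal (bernstein_poly \<alpha> x * dirichlet_density \<theta> x) \<partial>lborel) = ennreal (dirichlet_moment \<theta> \<alpha>)"
    unfolding eq .
  moreover have "0 \<le> dirichlet_moment \<theta> \<alpha>"
    unfolding dirichlet_moment_def using T
    by (intro mult_nonneg_nonneg divide_nonneg_nonneg prod_nonneg pochhammer_nonneg)
       (auto simp: T_def[symmetric] pos intro!: divide_nonneg_nonneg pochhammer_nonneg)
  moreover have "0 \<le> bernstein_poly \<alpha> x * dirichlet_density \<theta> x" for x :: "real ^ 'n"
    unfolding eq using C prod_powr_bary_coord_nonneg by (intro mult_nonneg_nonneg) auto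
  moreover have "(\<lambda>x::real^'n. bernstein_poly \<alpha> x * dirichlet_density \<theta> x) \<in> borel_measurable lborel"
    unfolding bernstein_poly_def[abs_def] by measurable
  ultimately show ?thesis
    by (intro has_bochner_integral_nn_integral) auto
qed

section \<open>The image of a measure under one step of the chain\<close>

lemma unit_simplex_borel [measurable]: "(unit_simplex :: (real ^ 'n::finite) set) \<in> sets borel"
  by (simp add: borel_closed compact_imp_closed compact_unit_simplex)

lemma simplex_segment:
  fixes x :: "real ^ 'n::finite"
  assumes "x \<in> unit_simplex" "t \<in> {0..1}"
  shows "t *\<^sub>R x + (1 - t) *\<^sub>R simplex_vertex i \<in> unit_simplex"
  using assms by (auto simp: bary_coord_nonneg_iff bary_coord_segment intro!: add_nonneg_nonneg)

lemma
  fixes h :: "real ^ 'n::finite \<Rightarrow> real"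
  assumes "(\<lambda>x. indicator unit_simplex x * h x) \<in> borel_measurable borel"
  shows LINT_lebesgue_on_simplex:
      "(LINT x|lebesgue_on unit_simplex. h x) = (LINT x|lborel. indicator unit_simplex x * h x)"
    and integrable_lebesgue_on_simplex:
      "integrable (lebesgue_on unit_simplex) h \<longleftrightarrow> integrable lborel (\<lambda>x. indicator unit_simplex x * h x)"
  using assms by (simp_all add: integral_restrict_space integrable_restrict_space
      integral_completion integrable_completion)

text \<open>Turns the functional \<open>F \<mapsto> \<integral> P F d\<mu>\<close> into integration against a measure, so that moment
determinacy extends an identity from monomials to all bounded Borel functions. The measure \<open>\<nu>\<close> is
the law of the chain after one step from \<open>\<mu>\<close>: on triples of a vertex, a starting point and a
\<open>t \<in> {0..1}\<close>, weight the product measure by \<open>p\<close> and push it forward to the new position.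
The values of \<open>p\<close> outside the simplex are arbitrary, hence the indicators.\<close>

lemma df_operator_dual_measure:
  fixes p :: "'n::finite option \<Rightarrow> real ^ 'n \<Rightarrow> real"
  assumes p: "df_weights p"
    and \<mu>: "finite_measure \<mu>" "sets \<mu> = sets borel"
  obtains \<nu> where "finite_measure \<nu>" "sets \<nu> = sets borel" "AE x in \<nu>. x \<in> unit_simplex"
    "\<And>F. F \<in> borel_measurable borel \<Longrightarrow> bounded (F ` unit_simplex) \<Longrightarrow>
       (\<lambda>x. indicator unit_simplex x * df_operator p F x) \<in> borel_measurable borel \<and>
       (LINT x|\<nu>. F x) = (LINT x|\<mu>. indicator unit_simplex x * df_operator p F x)"
proof -
  let ?S = "unit_simplex :: (real ^ 'n) set"
  define U where "U = restrict_space lborel {0..1::real}"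
  define C where "C = (count_space UNIV :: 'n option measure)"
  define Q where "Q = C \<Otimes>\<^sub>M (\<mu> \<Otimes>\<^sub>M U)"
  define w where "w = (\<lambda>i x. indicator ?S x * p i x)"
  define T where "T = (\<lambda>i x t. t *\<^sub>R x + (1 - t) *\<^sub>R simplex_vertex i :: real ^ 'n)"
  have fU: "finite_measure U"
    unfolding U_def by (rule finite_measureI) (simp add: space_restrict_space emeasure_restrict_space)
  have fC: "finite_measure C"
    unfolding C_def by (rule finite_measureI) simp
  interpret \<mu>: finite_measure \<mu> by fact
  interpret U: finite_measure U by fact
  interpret C: finite_measure C by fact
  interpret \<mu>U: pair_sigma_finite \<mu> U ..
  interpret \<mu>Uf: finite_measure "\<mu> \<Otimes>\<^sub>M U" by (rule finite_measure_pair_measure[OF fU \<mu>(1)])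
  interpret QQ: pair_sigma_finite C "\<mu> \<Otimes>\<^sub>M U" ..
  interpret Q: finite_measure Q
    unfolding Q_def by (rule finite_measure_pair_measure[OF \<mu>Uf.finite_measure_axioms fC])
  have space: "space U = {0..1}" "space C = UNIV" by (simp_all add: U_def C_def space_restrict_space)
  have [measurable_cong]: "sets \<mu> = sets borel" by fact
  have U_id [measurable]: "(\<lambda>t. t) \<in> borel_measurable U"
    unfolding U_def by (rule measurable_restrict_space1) simp
  have [measurable]: "(\<lambda>z. fst z) \<in> borel_measurable (\<mu> \<Otimes>\<^sub>M U)" by measurable
  have [measurable]: "(\<lambda>z. snd z) \<in> borel_measurable (\<mu> \<Otimes>\<^sub>M U)"
    using measurable_compose[OF measurable_snd U_id] .
  have w_nonneg: "0 \<le> w i x" for i x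
    using p by (auto simp: w_def df_weights_def indicator_def)
  have w_sum: "(\<Sum>i\<in>UNIV. w i x) \<le> 1" for x
    using p by (auto simp: w_def df_weights_def indicator_def)
  have w_le: "w i x \<le> 1" for i x
    using w_sum[of x] member_le_sum[of i UNIV "\<lambda>i. w i x"] w_nonneg by fastforce
  have [measurable]: "w i \<in> borel_measurable borel" for i
    using p borel_measurable_continuous_on_indicator[of ?S "p i"] unfolding w_def df_weights_def by simp
  have [measurable]: "(\<lambda>z. T i (fst z) (snd z)) \<in> borel_measurable (\<mu> \<Otimes>\<^sub>M U)" for i
    unfolding T_def by measurable
  define W where "W = (\<lambda>z :: 'n option \<times> (real ^ 'n) \<times> real. w (fst z) (fst (snd z)))"
  define TT where "TT = (\<lambda>z :: 'n option \<times> (real ^ 'n) \<times> real. T (fst z) (fst (snd z)) (snd (snd z)))"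
  have [measurable]: "W \<in> borel_measurable Q"
    unfolding Q_def C_def by (rule measurable_pair_measure_countable1) (auto simp: W_def)
  have [measurable]: "TT \<in> borel_measurable Q"
    unfolding Q_def C_def by (rule measurable_pair_measure_countable1) (auto simp: TT_def)
  have W_nonneg: "0 \<le> W z" for z by (simp add: W_def w_nonneg)
  have TT_in: "TT z \<in> ?S" if "z \<in> space Q" "W z \<noteq> 0" for z
  proof -
    have "fst (snd z) \<in> ?S" using that(2) by (auto simp: W_def w_def indicator_def split: if_splits)
    moreover have "snd (snd z) \<in> {0..1}" using that(1) by (auto simp: Q_def space_pair_measure space)
    ultimately show ?thesis unfolding TT_def T_def by (rule simplex_segment)
  qed
  define \<nu> where "\<nu> = distr (density Q (\<lambda>z. ennreal (W z))) borel TT"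
  show ?thesis
  proof
    have "(\<integral>\<^sup>+z. ennreal (W z) \<partial>Q) \<le> (\<integral>\<^sup>+z. 1 \<partial>Q)"
      by (intro nn_integral_mono) (simp add: W_def w_le)
    also have "(\<integral>\<^sup>+z. 1 \<partial>Q) < \<infinity>"
      using Q.emeasure_finite[of "space Q"] by (simp add: less_top[symmetric])
    finally have "emeasure (density Q (\<lambda>z. ennreal (W z))) (space Q) < \<infinity>"
      by (simp add: emeasure_density cong: nn_integral_cong)
    then have "finite_measure (density Q (\<lambda>z. ennreal (W z)))"
      by (intro finite_measureI) simp
    then show "finite_measure \<nu>"
      unfolding \<nu>_def by (rule finite_measure.finite_measure_distr) simp
    show "sets \<nu> = sets borel" by (simp add: \<nu>_def)
    show "AE x in \<nu>. x \<in> unit_simplex"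
      unfolding \<nu>_def
      by (subst AE_distr_iff) (auto simp: AE_density intro!: AE_I2 TT_in)
    fix F :: "real ^ 'n \<Rightarrow> real"
    assume F [measurable]: "F \<in> borel_measurable borel" and "bounded (F ` unit_simplex)"
    then obtain B where B: "\<And>x. x \<in> unit_simplex \<Longrightarrow> \<bar>F x\<bar> \<le> B" by (auto simp: bounded_iff)
    have bd: "norm (W z * F (TT z)) \<le> max 0 B" if "z \<in> space Q" for z
    proof (cases "W z = 0")
      case False
      have "0 \<le> W z" "W z \<le> 1" by (simp_all add: W_def w_nonneg w_le)
      then have "\<bar>W z\<bar> * \<bar>F (TT z)\<bar> \<le> 1 * B"
        using B[OF TT_in[OF that False]] by (intro mult_mono) auto
      then show ?thesis by (simp add: abs_mult)
    qed simp
    have int: "integrable Q (\<lambda>z. W z * F (TT z))"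
    proof (rule Q.integrable_const_bound[of _ "max 0 B"])
      show "AE z in Q. norm (W z * F (TT z)) \<le> max 0 B" by (rule AE_I2) (rule bd)
    qed simp
    have int_i: "integrable (\<mu> \<Otimes>\<^sub>M U) (\<lambda>z. w i (fst z) * F (T i (fst z) (snd z)))" for i
    proof (rule \<mu>Uf.integrable_const_bound[of _ "max 0 B"])
      show "AE z in \<mu> \<Otimes>\<^sub>M U. norm (w i (fst z) * F (T i (fst z) (snd z))) \<le> max 0 B"
        using bd[of "(i, z)" for z] by (auto intro!: AE_I2 simp: Q_def W_def TT_def space_pair_measure space)
    qed simp
    have inner: "(LINT t|U. w i x * F (T i x t)) = w i x * (LINT t:{0..1}|lborel. F (T i x t))" for i x
      by (simp add: U_def integral_restrict_space set_lebesgue_integral_def)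
    have op: "indicator unit_simplex x * df_operator p F x = (\<Sum>i\<in>UNIV. LINT t|U. w i x * F (T i x t))" for x
      unfolding inner by (simp add: df_operator_def w_def T_def sum_distrib_left mult.assoc)
    have [measurable]: "(\<lambda>x. LINT t|U. w i x * F (T i x t)) \<in> borel_measurable \<mu>" for i
      by (rule U.borel_measurable_lebesgue_integral) (simp add: case_prod_beta')
    (* Fubini, first over the vertex and then over the starting point and t. *)
    have "(LINT x|\<nu>. F x) = (LINT z|Q. W z * F (TT z))"
      unfolding \<nu>_def by (simp add: integral_distr integral_density W_nonneg)
    also have "\<dots> = (LINT i|C. LINT z|(\<mu> \<Otimes>\<^sub>M U). W (i, z) * F (TT (i, z)))"
      using QQ.integral_fst'[OF int[unfolded Q_def]] by (simp add: Q_def)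
    also have "\<dots> = (\<Sum>i\<in>UNIV. LINT z|(\<mu> \<Otimes>\<^sub>M U). w i (fst z) * F (T i (fst z) (snd z)))"
      by (simp add: C_def lebesgue_integral_count_space_finite W_def TT_def)
    also have "\<dots> = (\<Sum>i\<in>UNIV. LINT x|\<mu>. LINT t|U. w i x * F (T i x t))"
      using \<mu>U.integral_fst'[OF int_i] by simp
    also have "\<dots> = (LINT x|\<mu>. (\<Sum>i\<in>UNIV. LINT t|U. w i x * F (T i x t)))"
      using \<mu>U.integrable_fst'[OF int_i] by (intro Bochner_Integration.integral_sum[symmetric]) simp
    finally show "(\<lambda>x. indicator unit_simplex x * df_operator p F x) \<in> borel_measurable borel \<and>
        (LINT x|\<nu>. F x) = (LINT x|\<mu>. indicator unit_simplex x * df_operator p F x)"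
      unfolding op by (simp cong: measurable_cong_sets)
  qed
qed

lemma abs_bernstein_poly_le:
  "x \<in> unit_simplex \<Longrightarrow> \<bar>bernstein_poly \<alpha> x\<bar> \<le> fact (\<Sum>i\<in>UNIV. \<alpha> i)"
proof -
  assume x: "x \<in> unit_simplex"
  have "1 \<le> (\<Prod>i\<in>UNIV. fact (\<alpha> i) :: real)" by (intro prod_ge_1) auto
  then have "fact (\<Sum>i\<in>UNIV. \<alpha> i) / (\<Prod>i\<in>UNIV. fact (\<alpha> i)) \<le> (fact (\<Sum>i\<in>UNIV. \<alpha> i) :: real)"
    by (simp add: divide_le_eq_1 field_simps)
  then have "fact (\<Sum>i\<in>UNIV. \<alpha> i) / (\<Prod>i\<in>UNIV. fact (\<alpha> i)) * bary_monomial \<alpha> x \<le> fact (\<Sum>i\<in>UNIV. \<alpha> i) * 1"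
    using bary_monomial_bounds[OF x, of \<alpha>] by (intro mult_mono) auto
  then show ?thesis
    using bary_monomial_bounds[OF x, of \<alpha>] by (simp add: bernstein_poly_def prod_nonneg)
qed

lemma borel_measurable_bernstein_poly [measurable]: "bernstein_poly \<alpha> \<in> borel_measurable borel"
  unfolding bernstein_poly_def[abs_def] by measurable

lemma bounded_bernstein_poly: "bounded (bernstein_poly \<alpha> ` unit_simplex)"
  unfolding bounded_iff using abs_bernstein_poly_le by auto

section \<open>Invariant densities\<close>

lemma LINT_df_operator_bernstein_poly:
  fixes \<theta> :: "'n::finite option \<Rightarrow> real"
  assumes p: "\<And>i y. y \<in> unit_simplex \<Longrightarrow> p i y = affine_weight \<theta> i y"
    and g: "integrable (lebesgue_on unit_simplex) g"
    and \<alpha>: "(\<Sum>j\<in>UNIV. \<alpha> j) \<noteq> 0"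
    and M: "M = (\<lambda>\<alpha>. LINT x|lebesgue_on unit_simplex. bernstein_poly \<alpha> x * g x)"
  shows "(LINT x|lebesgue_on unit_simplex. df_operator p (bernstein_poly \<alpha>) x * g x) =
    ((2 - (\<Sum>j\<in>UNIV. \<theta> j)) * M \<alpha>
       + (\<Sum>i\<in>UNIV. \<Sum>k<\<alpha> i. moment_coeff \<theta> \<alpha> i k * M (\<alpha>(i := k))))
    / (real (\<Sum>j\<in>UNIV. \<alpha> j) + 1)"
proof -
  let ?L = "lebesgue_on (unit_simplex :: (real ^ 'n) set)"
  have int [simp]: "integrable ?L (\<lambda>x. bernstein_poly \<alpha> x * g x)" for \<alpha>
  proof (rule Bochner_Integration.integrable_bound)
    show "integrable ?L (\<lambda>x. fact (\<Sum>i\<in>UNIV. \<alpha> i) * g x)" using g by simp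
    have "bernstein_poly \<alpha> \<in> borel_measurable ?L"
      by (intro measurable_restrict_space1 measurable_completion) simp
    then show "(\<lambda>x. bernstein_poly \<alpha> x * g x) \<in> borel_measurable ?L"
      using g by simp
    show "AE x in ?L. norm (bernstein_poly \<alpha> x * g x) \<le> norm (fact (\<Sum>i\<in>UNIV. \<alpha> i) * g x)"
      by (intro AE_I2) (auto simp: abs_mult space_restrict_space intro!: mult_right_mono abs_bernstein_poly_le)
  qed
  have "(LINT x|?L. df_operator p (bernstein_poly \<alpha>) x * g x) =
     (LINT x|?L. ((2 - (\<Sum>j\<in>UNIV. \<theta> j)) * (bernstein_poly \<alpha> x * g x)
       + (\<Sum>i\<in>UNIV. \<Sum>k<\<alpha> i. moment_coeff \<theta> \<alpha> i k * (bernstein_poly (\<alpha>(i := k)) x * g x)))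
       / (real (\<Sum>j\<in>UNIV. \<alpha> j) + 1))"
  proof (intro Bochner_Integration.integral_cong refl)
    fix x assume "x \<in> space ?L"
    then have x: "x \<in> unit_simplex" by (simp add: space_restrict_space)
    have op: "df_operator p (bernstein_poly \<alpha>) x = ((2 - (\<Sum>j\<in>UNIV. \<theta> j)) * bernstein_poly \<alpha> x
       + (\<Sum>i\<in>UNIV. \<Sum>k<\<alpha> i. moment_coeff \<theta> \<alpha> i k * bernstein_poly (\<alpha>(i := k)) x))
       / (real (\<Sum>j\<in>UNIV. \<alpha> j) + 1)"
      by (rule df_operator_bernstein_poly[OF x _ \<alpha>]) (rule p)
    show "df_operator p (bernstein_poly \<alpha>) x * g x = ((2 - (\<Sum>j\<in>UNIV. \<theta> j)) * (bernstein_poly \<alpha> x * g x)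
       + (\<Sum>i\<in>UNIV. \<Sum>k<\<alpha> i. moment_coeff \<theta> \<alpha> i k * (bernstein_poly (\<alpha>(i := k)) x * g x)))
       / (real (\<Sum>j\<in>UNIV. \<alpha> j) + 1)"
      unfolding op by (simp only: times_divide_eq_left distrib_right sum_distrib_right mult.assoc)
  qed
  then show ?thesis by (simp add: M del: of_nat_sum)
qed

text \<open>Bernstein polynomials are admissible test functions, and for them invariance is precisely the
recurrence solved by the Dirichlet moments.\<close>

lemma invariant_density_moments:
  fixes \<theta> :: "'n::finite option \<Rightarrow> real"
  assumes p: "\<And>i y. y \<in> unit_simplex \<Longrightarrow> p i y = affine_weight \<theta> i y"
    and pos: "\<And>i. \<theta> i > 0"
    and g: "df_invariant_density p g"
  shows "(LINT x|lebesgue_on unit_simplex. bernstein_poly \<alpha> x * g x) = dirichlet_moment \<theta> \<alpha>"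
proof -
  define M where "M = (\<lambda>\<alpha>. LINT x|lebesgue_on unit_simplex. bernstein_poly \<alpha> x * g x)"
  have int: "integrable (lebesgue_on unit_simplex) g" using g by (simp add: df_invariant_density_def)
  have inv: "(LINT x|lebesgue_on unit_simplex. df_operator p (bernstein_poly \<alpha>) x * g x) = M \<alpha>" for \<alpha>
  proof -
    have "bernstein_poly \<alpha> \<in> borel_measurable (restrict_space borel unit_simplex)"
      by (intro measurable_restrict_space1) simp
    moreover have "df_dual p g g" using g by (simp add: df_invariant_density_def)
    ultimately show ?thesis
      using bounded_bernstein_poly[of \<alpha>] unfolding df_dual_def M_def by blast
  qed
  have "M \<alpha> = dirichlet_moment \<theta> \<alpha>" for \<alpha>
  proof (rule moments_eq_dirichlet_moment[OF pos])
    show "M (\<lambda>_. 0) = 1" using g by (simp add: M_def df_invariant_density_def)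
    fix \<alpha> :: "'n option \<Rightarrow> nat"
    assume nz: "(\<Sum>j\<in>UNIV. \<alpha> j) \<noteq> 0"
    have solve: "X = (n - 1 + T) * m" if "m = ((2 - T) * m + X) / (n + 1)" "n \<ge> 0" for m X n T :: real
    proof -
      have "n + 1 \<noteq> 0" using that(2) by linarith
      from iffD1[OF nonzero_eq_divide_eq[OF this] that(1)] show ?thesis by algebra
    qed
    show "(\<Sum>i\<in>UNIV. \<Sum>k<\<alpha> i. moment_coeff \<theta> \<alpha> i k * M (\<alpha>(i := k))) =
        (real (\<Sum>j\<in>UNIV. \<alpha> j) - 1 + (\<Sum>j\<in>UNIV. \<theta> j)) * M \<alpha>"
    proof (rule solve)
      show "M \<alpha> = ((2 - (\<Sum>j\<in>UNIV. \<theta> j)) * M \<alpha>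
         + (\<Sum>i\<in>UNIV. \<Sum>k<\<alpha> i. moment_coeff \<theta> \<alpha> i k * M (\<alpha>(i := k)))) / (real (\<Sum>j\<in>UNIV. \<alpha> j) + 1)"
        by (rule trans[OF inv[symmetric]], rule LINT_df_operator_bernstein_poly[OF _ int nz M_def]) (rule p)
    qed (simp add: sum_nonneg)
  qed
  then show ?thesis by (simp add: M_def)
qed

lemma measure_on_simplex_eqI_bernstein:
  fixes M N :: "(real ^ 'n::finite) measure"
  assumes "finite_measure M" "finite_measure N" "sets M = sets borel" "sets N = sets borel"
    and "AE x in M. x \<in> unit_simplex" "AE x in N. x \<in> unit_simplex"
    and eq: "\<And>\<alpha>. (LINT x|M. bernstein_poly \<alpha> x) = (LINT x|N. bernstein_poly \<alpha> x)"
  shows "M = N"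
proof (rule measure_on_simplex_eqI)
  fix \<alpha> :: "'n option \<Rightarrow> nat"
  have "(\<Prod>i\<in>UNIV. fact (\<alpha> i) :: real) \<noteq> 0" by simp
  then show "(LINT x|M. bary_monomial \<alpha> x) = (LINT x|N. bary_monomial \<alpha> x)"
    using eq[of \<alpha>] by (simp add: bernstein_poly_def)
qed fact+

lemma LINT_simplex_density:
  fixes g h :: "real ^ 'n::finite \<Rightarrow> real"
  assumes [measurable]: "g \<in> borel_measurable borel" "(\<lambda>x. indicator unit_simplex x * h x) \<in> borel_measurable borel"
    and nonneg: "\<And>x. 0 \<le> g x"
  shows "(LINT x|lebesgue_on unit_simplex. h x * g x) =
     (LINT x|density lborel (\<lambda>x. ennreal (g x)). indicator unit_simplex x * h x)"
proof -
  have "(\<lambda>x. indicator unit_simplex x * (h x * g x)) = (\<lambda>x. g x * (indicator unit_simplex x * h x))"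
    by (auto simp: ac_simps)
  then show ?thesis
    using nonneg by (subst LINT_lebesgue_on_simplex) (simp_all add: integral_density)
qed

lemma simplex_density_measure:
  fixes g :: "real ^ 'n::finite \<Rightarrow> real"
  assumes [measurable]: "g \<in> borel_measurable borel"
    and nonneg: "\<And>x. 0 \<le> g x" and zero: "\<And>x. x \<notin> unit_simplex \<Longrightarrow> g x = 0"
    and int: "integrable lborel g"
  defines "\<mu> \<equiv> density lborel (\<lambda>x. ennreal (g x))"
  shows "finite_measure \<mu>" "sets \<mu> = sets borel" "AE x in \<mu>. x \<in> unit_simplex"
proof -
  have "(\<integral>\<^sup>+x. ennreal (g x) \<partial>lborel) < \<infinity>"
    using int nonneg by (simp add: integrable_iff_bounded)
  then show "finite_measure \<mu>"
    unfolding \<mu>_def by (intro finite_measureI) (simp add: emeasure_density)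
  show "sets \<mu> = sets borel" by (simp add: \<mu>_def)
  show "AE x in \<mu>. x \<in> unit_simplex"
  proof -
    have "x \<in> unit_simplex" if "0 < g x" for x using that zero[of x] by fastforce
    then show ?thesis unfolding \<mu>_def by (subst AE_density) (auto intro!: AE_I2)
  qed
qed

lemma LINT_simplex_indicator:
  assumes "AE x in M. x \<in> unit_simplex" "sets M = sets borel" "h \<in> borel_measurable borel"
  shows "(LINT x|M. indicator unit_simplex x * h x) = (LINT x|M. h x :: real)"
proof -
  have [measurable_cong]: "sets M = sets borel" and [measurable]: "h \<in> borel_measurable borel" by fact+
  show ?thesis using assms(1) by (intro integral_cong_AE) auto
qed

text \<open>Invariance says that the law \<open>\<nu>\<close> of the chain after one step from the Dirichlet distribution \<open>\<mu>\<close>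
is again \<open>\<mu>\<close>. The recurrence shows that \<open>\<nu>\<close> and \<open>\<mu>\<close> have the same moments.\<close>

lemma dirichlet_invariant:
  fixes \<theta> :: "'n::finite option \<Rightarrow> real"
  assumes p: "\<And>i y. y \<in> unit_simplex \<Longrightarrow> p i y = affine_weight \<theta> i y"
    and weights: "df_weights p"
    and pos: "\<And>i. \<theta> i > 0"
  shows "df_invariant_density p (dirichlet_density \<theta>)"
proof -
  let ?S = "unit_simplex :: (real ^ 'n) set"
  let ?D = "dirichlet_density \<theta>"
  note D_nonneg = dirichlet_density_nonneg[of \<theta>, OF pos]
  define \<mu> where "\<mu> = density lborel (\<lambda>x. ennreal (?D x))"
  have ind_D: "indicator ?S x * (h x * ?D x) = h x * ?D x" for x h
    by (cases "x \<in> ?S") (auto simp: dirichlet_density_eq_0)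
  have moment: "(LINT x|lebesgue_on ?S. bernstein_poly \<alpha> x * ?D x) = dirichlet_moment \<theta> \<alpha>" for \<alpha>
    using has_bochner_integral_dirichlet_moment[of \<theta> \<alpha>, OF pos]
    by (subst LINT_lebesgue_on_simplex) (auto simp: ind_D has_bochner_integral_iff)
  have int: "integrable lborel ?D"
    using has_bochner_integral_dirichlet_moment[of \<theta> "\<lambda>_. 0", OF pos] by (simp add: has_bochner_integral_iff)
  have int_S: "integrable (lebesgue_on ?S) ?D"
    using int ind_D[of _ "\<lambda>_. 1"] by (subst integrable_lebesgue_on_simplex) (simp_all only: mult_1_left, measurable)
  note \<mu> = simplex_density_measure[OF borel_measurable_dirichlet_density D_nonneg dirichlet_density_eq_0 int, folded \<mu>_def]
  obtain \<nu> where \<nu>: "finite_measure \<nu>" "sets \<nu> = sets borel" "AE x in \<nu>. x \<in> ?S"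
    "\<And>F. F \<in> borel_measurable borel \<Longrightarrow> bounded (F ` ?S) \<Longrightarrow>
       (\<lambda>x. indicator ?S x * df_operator p F x) \<in> borel_measurable borel \<and>
       (LINT x|\<nu>. F x) = (LINT x|\<mu>. indicator ?S x * df_operator p F x)"
    using df_operator_dual_measure[OF weights \<mu>(1,2)] by blast
  have \<nu>_eq: "(LINT x|\<nu>. F x) = (LINT x|lebesgue_on ?S. df_operator p F x * ?D x)"
    if "F \<in> borel_measurable borel" "bounded (F ` ?S)" for F
    using \<nu>(4)[OF that] LINT_simplex_density[OF borel_measurable_dirichlet_density _ D_nonneg]
    by (simp add: \<mu>_def)
  have "\<nu> = \<mu>"
  proof (rule measure_on_simplex_eqI_bernstein[OF \<nu>(1) \<mu>(1) \<nu>(2) \<mu>(2) \<nu>(3) \<mu>(3)])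
    fix \<alpha> :: "'n option \<Rightarrow> nat"
    have "(LINT x|lebesgue_on ?S. df_operator p (bernstein_poly \<alpha>) x * ?D x) = dirichlet_moment \<theta> \<alpha>"
    proof (cases "(\<Sum>j\<in>UNIV. \<alpha> j) = 0")
      case True
      then have \<alpha>: "\<alpha> = (\<lambda>_. 0)" by auto
      have "df_operator p (bernstein_poly \<alpha>) x = 1" if "x \<in> ?S" for x
        using that weights by (simp add: \<alpha> df_operator_def df_weights_def set_lebesgue_integral_def)
      then have "(LINT x|lebesgue_on ?S. df_operator p (bernstein_poly \<alpha>) x * ?D x) =
          (LINT x|lebesgue_on ?S. bernstein_poly \<alpha> x * ?D x)"
        by (intro Bochner_Integration.integral_cong) (auto simp: space_restrict_space \<alpha>)
      then show ?thesis by (simp add: moment)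
    next
      case False
      have solve: "((2 - T) * m + (n - 1 + T) * m) / (n + 1) = m" if "n \<ge> 0" for m n T :: real
        using that by (simp add: field_simps)
      have "(LINT x|lebesgue_on ?S. df_operator p (bernstein_poly \<alpha>) x * ?D x) =
         ((2 - (\<Sum>j\<in>UNIV. \<theta> j)) * dirichlet_moment \<theta> \<alpha>
           + (\<Sum>i\<in>UNIV. \<Sum>k<\<alpha> i. moment_coeff \<theta> \<alpha> i k * dirichlet_moment \<theta> (\<alpha>(i := k))))
         / (real (\<Sum>j\<in>UNIV. \<alpha> j) + 1)"
        by (rule LINT_df_operator_bernstein_poly[OF _ int_S False]) (simp_all add: p moment)
      then show ?thesis
        unfolding dirichlet_moment_recurrence[OF pos False] by (subst (asm) solve) (simp_all add: sum_nonneg)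
    qed
    then have "(LINT x|\<nu>. bernstein_poly \<alpha> x) = dirichlet_moment \<theta> \<alpha>"
      by (simp add: \<nu>_eq bounded_bernstein_poly)
    also have "\<dots> = (LINT x|\<mu>. indicator ?S x * bernstein_poly \<alpha> x)"
      unfolding moment[symmetric] \<mu>_def by (rule LINT_simplex_density) (auto intro: D_nonneg)
    also have "\<dots> = (LINT x|\<mu>. bernstein_poly \<alpha> x)"
      by (rule LINT_simplex_indicator[OF \<mu>(3,2)]) simp_all
    finally show "(LINT x|\<nu>. bernstein_poly \<alpha> x) = (LINT x|\<mu>. bernstein_poly \<alpha> x)" .
  qed
  have "(LINT x|lebesgue_on ?S. df_operator p f x * ?D x) = (LINT x|lebesgue_on ?S. f x * ?D x)"
    if f: "f \<in> borel_measurable (restrict_space borel ?S)" and bd: "bounded (f ` ?S)" for f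
  proof -
    (* f is measurable on the simplex only; the chain never leaves the simplex, so extending f
       by 0 does not change its image under the operator there. *)
    define F where "F = (\<lambda>x. indicator ?S x * f x)"
    have F [measurable]: "F \<in> borel_measurable borel"
      using f by (simp add: F_def borel_measurable_restrict_space_iff)
    have Ff: "F x = f x" if "x \<in> ?S" for x using that by (simp add: F_def)
    have "F ` ?S = f ` ?S" using Ff by auto
    then have bdF: "bounded (F ` ?S)" using bd by simp
    have "df_operator p f x = df_operator p F x" if "x \<in> ?S" for x
      unfolding df_operator_def set_lebesgue_integral_def using that
      by (intro sum.cong arg_cong2[where f="(*)"] Bochner_Integration.integral_cong refl)
         (auto simp: indicator_def Ff simplex_segment)
    then have "(LINT x|lebesgue_on ?S. df_operator p f x * ?D x) = (LINT x|\<nu>. F x)"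
      unfolding \<nu>_eq[OF F bdF]
      by (intro Bochner_Integration.integral_cong) (auto simp: space_restrict_space)
    also have "\<dots> = (LINT x|\<mu>. indicator ?S x * f x)"
      by (simp add: \<open>\<nu> = \<mu>\<close> F_def)
    also have "\<dots> = (LINT x|lebesgue_on ?S. f x * ?D x)"
      unfolding \<mu>_def using F by (subst LINT_simplex_density) (simp_all add: F_def D_nonneg)
    finally show ?thesis .
  qed
  then show ?thesis
    unfolding df_invariant_density_def df_dual_def
    using int_S moment[of "\<lambda>_. 0"] by (auto simp: D_nonneg dirichlet_moment_def)
qed

text \<open>Two invariant densities have the same moments, hence define the same Borel measure. Densities are
only Lebesgue measurable, so each is first replaced by a Borel representative that is nonnegative
everywhere and vanishes outside the simplex.\<close>

lemma invariant_density_unique: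
  fixes \<theta> :: "'n::finite option \<Rightarrow> real"
  assumes p: "\<And>i y. y \<in> unit_simplex \<Longrightarrow> p i y = affine_weight \<theta> i y"
    and pos: "\<And>i. \<theta> i > 0"
    and g: "df_invariant_density p g" and h: "df_invariant_density p h"
  shows "AE y in lebesgue_on unit_simplex. g y = h y"
proof -
  let ?S = "unit_simplex :: (real ^ 'n) set"
  have S_leb: "?S \<in> sets lebesgue" by simp
  have rep: "\<exists>g'. g' \<in> borel_measurable borel \<and> (\<forall>x. 0 \<le> g' x) \<and> (\<forall>x. x \<notin> ?S \<longrightarrow> g' x = 0) \<and> integrable lborel g' \<and>
      (AE x in lebesgue_on ?S. g x = g' x) \<and>
      (\<forall>\<alpha>. (LINT x|density lborel (\<lambda>x. ennreal (g' x)). bernstein_poly \<alpha> x) = dirichlet_moment \<theta> \<alpha>)"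
    if g: "df_invariant_density p g" for g
  proof -
    have g_int: "integrable (lebesgue_on ?S) g" and g_nonneg: "AE x in lebesgue_on ?S. 0 \<le> g x"
      using g by (simp_all add: df_invariant_density_def)
    have "integrable lebesgue (\<lambda>x. indicator ?S x * g x)"
      using g_int by (simp add: integrable_restrict_space)
    then have "(\<lambda>x. indicator ?S x * g x) \<in> borel_measurable lebesgue" by simp
    from completion_ex_borel_measurable_real[OF this]
    obtain g0 where [measurable]: "g0 \<in> borel_measurable borel" and g0: "AE x in lborel. indicator ?S x * g x = g0 x"
      by auto
    define g' where "g' = (\<lambda>x. indicator ?S x * max 0 (g0 x))"
    have meas [measurable]: "g' \<in> borel_measurable borel" unfolding g'_def by measurable
    have nonneg: "0 \<le> g' x" for x by (simp add: g'_def)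
    have zero: "g' x = 0" if "x \<notin> ?S" for x using that by (simp add: g'_def)
    have ind: "indicator ?S x * g' x = g' x" for x by (simp add: g'_def indicator_def)
    have "AE x in lebesgue. x \<in> ?S \<longrightarrow> 0 \<le> g x"
      using g_nonneg by (simp add: AE_restrict_space_iff)
    then have "AE x in lebesgue. x \<in> ?S \<longrightarrow> g x = g' x"
      using AE_completion[OF g0] by eventually_elim (auto simp: g'_def)
    then have ae: "AE x in lebesgue_on ?S. g x = g' x"
      by (simp add: AE_restrict_space_iff)
    have meas_S: "f \<in> borel_measurable (lebesgue_on ?S)" if "f \<in> borel_measurable borel" for f :: "_ \<Rightarrow> real"
      using that by (intro measurable_restrict_space1 measurable_completion) simp
    have "integrable (lebesgue_on ?S) g'"
      using g_int integrable_cong_AE[OF _ meas_S[OF meas] ae] by simp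
    then have int: "integrable lborel g'"
      by (subst (asm) integrable_lebesgue_on_simplex) (simp_all add: ind)
    note \<mu> = simplex_density_measure[OF meas nonneg zero int]
    have "(LINT x|density lborel (\<lambda>x. ennreal (g' x)). bernstein_poly \<alpha> x) = dirichlet_moment \<theta> \<alpha>" for \<alpha>
    proof -
      have "(LINT x|density lborel (\<lambda>x. ennreal (g' x)). bernstein_poly \<alpha> x) =
          (LINT x|density lborel (\<lambda>x. ennreal (g' x)). indicator ?S x * bernstein_poly \<alpha> x)"
        by (rule LINT_simplex_indicator[OF \<mu>(3,2), symmetric]) simp_all
      also have "\<dots> = (LINT x|lebesgue_on ?S. bernstein_poly \<alpha> x * g' x)"
        by (rule LINT_simplex_density[symmetric]) (auto intro: nonneg)
      also have "\<dots> = (LINT x|lebesgue_on ?S. bernstein_poly \<alpha> x * g x)"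
      proof -
        have "bernstein_poly \<alpha> \<in> borel_measurable (lebesgue_on ?S)"
          by (rule meas_S) (rule borel_measurable_bernstein_poly)
        then show ?thesis
          using ae g_int meas_S[OF meas] by (intro integral_cong_AE) (auto elim!: eventually_mono)
      qed
      also have "\<dots> = dirichlet_moment \<theta> \<alpha>"
        by (rule invariant_density_moments[OF _ pos g]) (rule p)
      finally show ?thesis .
    qed
    then show ?thesis using meas nonneg zero int ae by blast
  qed
  obtain g' where g': "g' \<in> borel_measurable borel" "\<And>x. 0 \<le> g' x" "\<And>x. x \<notin> ?S \<Longrightarrow> g' x = 0" "integrable lborel g'"
      "AE x in lebesgue_on ?S. g x = g' x"
      "\<And>\<alpha>. (LINT x|density lborel (\<lambda>x. ennreal (g' x)). bernstein_poly \<alpha> x) = dirichlet_moment \<theta> \<alpha>"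
    using rep[OF g] by blast
  obtain h' where h': "h' \<in> borel_measurable borel" "\<And>x. 0 \<le> h' x" "\<And>x. x \<notin> ?S \<Longrightarrow> h' x = 0" "integrable lborel h'"
      "AE x in lebesgue_on ?S. h x = h' x"
      "\<And>\<alpha>. (LINT x|density lborel (\<lambda>x. ennreal (h' x)). bernstein_poly \<alpha> x) = dirichlet_moment \<theta> \<alpha>"
    using rep[OF h] by blast
  have "density lborel (\<lambda>x. ennreal (g' x)) = density lborel (\<lambda>x. ennreal (h' x))"
    using simplex_density_measure[OF g'(1-4)] simplex_density_measure[OF h'(1-4)]
    by (intro measure_on_simplex_eqI_bernstein) (simp_all add: g'(6) h'(6))
  then have "AE x in lborel. ennreal (g' x) = ennreal (h' x)"
    using g'(1) h'(1) by (intro sigma_finite_measure.density_unique[OF sigma_finite_lborel]) simp_all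
  then have "AE x in lborel. g' x = h' x"
    by eventually_elim (simp add: g'(2) h'(2))
  then have "AE x in lebesgue. x \<in> ?S \<longrightarrow> g' x = h' x"
    by (intro AE_completion) (auto elim!: eventually_mono)
  then have "AE x in lebesgue_on ?S. g' x = h' x"
    by (simp add: AE_restrict_space_iff)
  with g'(5) h'(5) show ?thesis by eventually_elim simp
qed

theorem theorem14:
  fixes \<theta> :: "'n::finite option \<Rightarrow> real"
    and p :: "'n option \<Rightarrow> real ^ 'n \<Rightarrow> real"
  assumes "CARD('n) \<ge> 2"
    and "\<And>i. \<theta> i > 0"
    and "(\<Sum>i\<in>UNIV. \<theta> i) \<le> 1"
    and "\<And>i y. y \<in> unit_simplex \<Longrightarrow>
           p (Some i) y = \<theta> (Some i) + (1 - (\<Sum>j\<in>UNIV. \<theta> j)) * y $ i"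
    and "\<And>y. y \<in> unit_simplex \<Longrightarrow> (\<Sum>i\<in>UNIV. p i y) = 1"
  shows "df_weights p
       \<and> (\<forall>y\<in>unit_simplex.
            p None y = \<theta> None + (1 - (\<Sum>j\<in>UNIV. \<theta> j)) * bary_coord y None)
       \<and> df_invariant_density p (dirichlet_density \<theta>)
       \<and> (\<forall>g. df_invariant_density p g \<longrightarrow>
            (AE y in lebesgue_on unit_simplex. g y = dirichlet_density \<theta> y))"
proof -
  have Some: "p (Some i) y = affine_weight \<theta> (Some i) y" if "y \<in> unit_simplex" for i y
    using assms(4)[OF that] by (simp add: affine_weight_def bary_coord_def)
  have None: "p None y = affine_weight \<theta> None y" if "y \<in> unit_simplex" for y
    using assms(5)[OF that] sum_affine_weight[of \<theta> y] Some[OF that] by (simp add: sum_option_UNIV)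
  have p: "p i y = affine_weight \<theta> i y" if "y \<in> unit_simplex" for i y
    using Some[OF that] None[OF that] by (cases i) auto
  have weights: "df_weights p"
    unfolding df_weights_def
  proof (intro conjI allI ballI)
    fix i
    have "continuous_on unit_simplex (affine_weight \<theta> i)"
      unfolding affine_weight_def by (intro continuous_intros)
    then show "continuous_on unit_simplex (p i)"
      by (rule continuous_on_eq) (simp add: p)
  next
    fix i and y :: "real ^ 'n" assume y: "y \<in> unit_simplex"
    show "0 \<le> p i y"
      using y assms(2)[of i] assms(3) by (simp add: p affine_weight_def bary_coord_nonneg_iff)
  qed (fact assms(5))
  have inv: "df_invariant_density p (dirichlet_density \<theta>)"
    by (rule dirichlet_invariant[OF _ weights assms(2)]) (rule p)
  have "AE y in lebesgue_on unit_simplex. g y = dirichlet_density \<theta> y" if "df_invariant_density p g" for g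
    by (rule invariant_density_unique[OF _ assms(2) that inv]) (rule p)
  then show ?thesis
    using weights None inv by (simp add: affine_weight_def)
qed

end
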